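(* Let $p$ be a prime and let $P(X,Y)=\sum_{i+j\le d} a_{ij}X^iY^j\in\overline{\mathbb{F}}_p[X,Y]$. Suppose that $P$ is irreducible, that $$\deg_X P=m\quad\text{and}\quad \deg_Y P=n,$$ and also that $P^{\sharp}(X,Y)$ consists of at least two monomials. There exists a constant $c_0(m,n)$, depending only on $m$ and $n$, such that for any multiplicative subgroup $\mathcal{G}\subseteq\overline{\mathbb{F}}_p$ of order $t=\#\mathcal{G}$ satisfying $$\frac12 p^{3/4}h^{-1/4}\ \ge\ t\ \ge\ \max\{h^2,\,c_0(m,n)\},$$ and any $h$ $\mathcal{G}$-independent polynomials $P_k(X,Y)=P(\lambda_kX,\mu_kY)$, $k=1,\ldots,h$, with $\lambda_k,\mu_k\in\overline{\mathbb{F}}_p^*$, we have $$\sum_{i=1}^h\#\{(u,v)\in\mathcal{G}^2 ~:~ P_i(u,v)=0\}<12\,mn(m+n)\,g\,h^{2/3}t^{2/3},$$ where $$g=\gcd\{\, i_1+j_1-i_2-j_2 ~:~ a_{i_1,j_1}a_{i_2,j_2}\neq 0\,\}.$$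
   Context: $\overline{\mathbb{F}}_p$ denotes the algebraic closure of the finite field $\mathbb{F}_p$ of $p$ elements, and $\overline{\mathbb{F}}_p^*$ is its set of nonzero elements. For a bivariate irreducible polynomial $P(X,Y)=\sum_{i+j\le d} a_{ij}X^iY^j\in\overline{\mathbb{F}}_p[X,Y]$ of total degree at most $d$, $P^{\sharp}(X,Y)$ is the homogeneous polynomial of degree $d^{\sharp}=\min\{i+j: a_{ij}\ne0\}$ given by $P^{\sharp}(X,Y)=\sum_{i+j=d^{\sharp}}a_{ij}X^iY^j$. The number $g$ is the greatest common divisor of the set of differences $i_1+j_1-i_2-j_2$ taken over all pairs of indices with $a_{i_1,j_1}a_{i_2,j_2}\ne 0$. Given a multiplicative subgroup $\mathcal{G}\subseteq\overline{\mathbb{F}}_p$, two polynomials $P,Q\in\overline{\mathbb{F}}_p[X,Y]$ are called $\mathcal{G}$-independent if there are no $(u,v)\in\mathcal{G}^2$ and $\gamma\in\overline{\mathbb{F}}_p^*$ such that the polynomials $P(X,Y)$ and $\gamma Q(uX,vY)$ coincide. The polynomials $P_1,\ldots,P_h$ are $\mathcal{G}$-independent if $P_i$ and $P_j$ are $\mathcal{G}$-independent for all $i\ne j$.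
   Formalization: The formal theorem assumes g ≠ 0, i.e. P is not homogeneous; this excludes only P = aX + bY, where all differences vanish, g = gcd{0} = 0, and the claimed strict inequality would say that a count is less than 0. *)

theory Defs
  imports
    Complex_Main
    "HOL-Computational_Algebra.Primes"
    "HOL-Number_Theory.Residues"
    "HOL-Algebra.UnivPoly"
    "HOL-Algebra.Ring_Divisibility"
    "HOL-Algebra.Algebraic_Closure"
begin

text \<open>
  The field is a locale-style ring rather than a type because the constant \<open>c\<^sub>0(m,n)\<close>
  has to be chosen before the prime \<open>p\<close>, so \<open>p\<close> must be a bound term variable.
\<close>

definition Fp_bar :: "nat \<Rightarrow> ((int list \<times> nat) multiset \<Rightarrow> int) ring" where
  "Fp_bar p = field.alg_closure (residue_ring (int p))"

text \<open>\<open>K[X,Y] = (K[X])[Y]\<close>: the inner variable is \<open>X\<close>, the outer variable is \<open>Y\<close>.\<close>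

definition biv :: "('a, 'b) ring_scheme \<Rightarrow> (nat \<Rightarrow> 'a, nat \<Rightarrow> nat \<Rightarrow> 'a) up_ring" where
  "biv K = UP (UP K)"

text \<open>The coefficient \<open>a\<^sub>i\<^sub>j\<close> of \<open>X\<^sup>iY\<^sup>j\<close>.\<close>

definition bcoeff :: "('a, 'b) ring_scheme \<Rightarrow> (nat \<Rightarrow> nat \<Rightarrow> 'a) \<Rightarrow> nat \<Rightarrow> nat \<Rightarrow> 'a" where
  "bcoeff K P i j = coeff (UP K) (coeff (biv K) P j) i"

definition bsupp :: "('a, 'b) ring_scheme \<Rightarrow> (nat \<Rightarrow> nat \<Rightarrow> 'a) \<Rightarrow> (nat \<times> nat) set" where
  "bsupp K P = {(i, j). bcoeff K P i j \<noteq> \<zero>\<^bsub>K\<^esub>}"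

definition deg_Y :: "('a, 'b) ring_scheme \<Rightarrow> (nat \<Rightarrow> nat \<Rightarrow> 'a) \<Rightarrow> nat" where
  "deg_Y K P = deg (UP K) P"

definition deg_X :: "('a, 'b) ring_scheme \<Rightarrow> (nat \<Rightarrow> nat \<Rightarrow> 'a) \<Rightarrow> nat" where
  "deg_X K P = Max ((\<lambda>j. deg K (coeff (biv K) P j)) ` {..deg_Y K P})"

definition beval :: "('a, 'b) ring_scheme \<Rightarrow> (nat \<Rightarrow> nat \<Rightarrow> 'a) \<Rightarrow> 'a \<Rightarrow> 'a \<Rightarrow> 'a" where
  "beval K P u v = eval (UP K) K (eval K K (\<lambda>c. c) u) v P"

text \<open>\<open>P(aX, bY)\<close>, whose coefficient at \<open>X\<^sup>iY\<^sup>j\<close> is \<open>a\<^sub>i\<^sub>ja\<^sup>ib\<^sup>j\<close>.\<close>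

definition bscale ::
    "('a, 'b) ring_scheme \<Rightarrow> 'a \<Rightarrow> 'a \<Rightarrow> (nat \<Rightarrow> nat \<Rightarrow> 'a) \<Rightarrow> (nat \<Rightarrow> nat \<Rightarrow> 'a)" where
  "bscale K a b P =
     (\<lambda>j i. bcoeff K P i j \<otimes>\<^bsub>K\<^esub> (a [^]\<^bsub>K\<^esub> i) \<otimes>\<^bsub>K\<^esub> (b [^]\<^bsub>K\<^esub> j))"

definition dsharp :: "('a, 'b) ring_scheme \<Rightarrow> (nat \<Rightarrow> nat \<Rightarrow> 'a) \<Rightarrow> nat" where
  "dsharp K P = Min ((\<lambda>(i, j). i + j) ` bsupp K P)"

definition sharp :: "('a, 'b) ring_scheme \<Rightarrow> (nat \<Rightarrow> nat \<Rightarrow> 'a) \<Rightarrow> (nat \<Rightarrow> nat \<Rightarrow> 'a)" where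
  "sharp K P = (\<lambda>j i. if i + j = dsharp K P then bcoeff K P i j else \<zero>\<^bsub>K\<^esub>)"

text \<open>
  If \<open>P\<close> is homogeneous then all differences vanish and \<open>Gcd {0} = 0\<close>, although the
  set \<open>{0}\<close> has no greatest common divisor in the literal sense.
\<close>

definition exp_gcd :: "('a, 'b) ring_scheme \<Rightarrow> (nat \<Rightarrow> nat \<Rightarrow> 'a) \<Rightarrow> int" where
  "exp_gcd K P = Gcd {int i1 + int j1 - int i2 - int j2 | i1 j1 i2 j2.
     bcoeff K P i1 j1 \<otimes>\<^bsub>K\<^esub> bcoeff K P i2 j2 \<noteq> \<zero>\<^bsub>K\<^esub>}"

text \<open>The scalar \<open>\<gamma>\<close> acts on \<open>(K[X])[Y]\<close> as the constant polynomial \<open>\<gamma>X\<^sup>0\<close> of \<open>K[X]\<close>.\<close>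

definition G_independent ::
    "('a, 'b) ring_scheme \<Rightarrow> 'a set \<Rightarrow> (nat \<Rightarrow> nat \<Rightarrow> 'a) \<Rightarrow> (nat \<Rightarrow> nat \<Rightarrow> 'a) \<Rightarrow> bool" where
  "G_independent K G P Q \<longleftrightarrow>
     \<not> (\<exists>u\<in>G. \<exists>v\<in>G. \<exists>\<gamma>\<in>carrier K - {\<zero>\<^bsub>K\<^esub>}.
          P = monom (UP K) \<gamma> 0 \<odot>\<^bsub>biv K\<^esub> bscale K u v Q)"

end

theory Submission
  imports Defs "HOL-Computational_Algebra.Polynomial_Factorial"
    "HOL-Computational_Algebra.Field_as_Ring"
begin

text \<open>
  The proof is Stepanov's method on a single curve. A solution \<open>(u, v)\<close> in \<open>G \<times> G\<close> of
  \<open>P(\<lambda>\<^sub>i u, \<mu>\<^sub>i v) = 0\<close> gives the point \<open>(x, y) = (\<lambda>\<^sub>i u, \<mu>\<^sub>i v)\<close> of the curve \<open>P = 0\<close>.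
  Independence makes the \<open>h\<close> pairs of cosets \<open>(\<lambda>\<^sub>i G, \<mu>\<^sub>i G)\<close> distinct, so no point arises
  from two indices, and the sum counts the points of \<open>P = 0\<close> for which \<open>(x^t, y^t)\<close> is one of
  at most \<open>h\<close> given pairs.

  The auxiliary polynomial has the form
  \<open>\<Psi> = (\<Sum>a<A. \<Sum>b<B. \<Sum>c<B. w(a,b,c) X^(a+bt) Y^(A-1-a+ct))\<close>. Differentiate it \<open>k\<close> times along
  the curve, with a derivation that multiplies monomials by polynomials of bidegree \<open>(m, n)\<close>.
  At the points above, \<open>X^t\<close> and \<open>Y^t\<close> are constants, so the result is a polynomial of
  degrees about \<open>A + km\<close> and \<open>A + kn\<close>, and modulo \<open>P\<close> these polynomials span a space of
  dimension at most \<open>(m+n)A + 2kmn\<close>. Vanishing to order \<open>D\<close> at all points therefore costs at most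
  \<open>hD((m+n)A + mnD)\<close> linear equations for \<open>AB\<^sup>2\<close> unknown coefficients
  (\<open>auxiliary_polynomial_exists\<close>).

  If \<open>P\<close> does not divide \<open>\<Psi>\<close>, Bezout's theorem with multiplicities
  (\<open>contact_order_bound\<close>) bounds \<open>D\<close> times the number of points by about \<open>(m+n)Bt\<close>. With
  \<open>B \<approx> (ht)^(1/3)\<close>, \<open>A \<approx> t/(gB)\<close> and \<open>D \<approx> A/(6mn)\<close> this gives the claim
  (\<open>stepanov_parameters\<close>). Where \<open>\<partial>P/\<partial>Y\<close> vanishes, \<open>X\<close> does not provide a local parameter of the curve;
  by Bezout's theorem again there are at most \<open>2mn\<close> such points.

  That \<open>P\<close> does not divide \<open>\<Psi>\<close> is the point where \<open>g\<close> and the lowest form of \<open>P\<close> enter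
  (\<open>not_dvd_stepanov_poly\<close>). For \<open>z \<in> G\<close> the substitution \<open>(zX, zY)\<close> multiplies \<open>\<Psi>\<close> by a scalar.
  So if \<open>P\<close> divides \<open>\<Psi>\<close>, then so do all \<open>P(zX, zY)\<close>. Two of these are associated only if the
  \<open>g\<close>-th powers of the two values of \<open>z\<close> agree, hence a product of \<open>t/g\<close> of them divides \<open>\<Psi>\<close>.
  Put \<open>X = ZY\<close> and compare the terms of lowest degree in \<open>Y\<close>: the \<open>(t/g)\<close>-th power of the lowest
  form \<open>P\<^sup>\<sharp>(Z, 1)\<close> divides a nonzero polynomial in \<open>Z\<close> with at most \<open>AB\<close> monomials, all of
  degree less than \<open>p\<close>. Since \<open>P\<^sup>\<sharp>(Z, 1)\<close> has two monomials, this is impossible when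
  \<open>AB \<le> t/g\<close> (\<open>power_dvd_lacunary\<close>).

  All of this holds over any field in which \<open>1, \<dots>, p - 1\<close> are nonzero, and it is carried out for
  iterated polynomials over a field that is a type, where unique factorization of
  \<open>K[X][Y]\<close> supplies that an irreducible \<open>P\<close> is prime. The last three sections carry the result
  over to a field given by a carrier set.
\<close>

section \<open>Linear relations\<close>

lemma nontrivial_relation:
  fixes v :: "'u \<Rightarrow> 'e \<Rightarrow> 'a::field"
  assumes "finite U" "finite E" "card E < card U"
  shows "\<exists>x. (\<exists>u\<in>U. x u \<noteq> 0) \<and> (\<forall>e\<in>E. (\<Sum>u\<in>U. x u * v u e) = 0)"
  using assms(2,1,3)
proof (induction E arbitrary: U v rule: finite_induct)
  case empty
  then obtain u where "u \<in> U" by (metis card.empty ex_in_conv less_irrefl)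
  then show ?case by (intro exI[of _ "\<lambda>_. 1"]) auto
next
  case (insert e E)
  show ?case
  proof (cases "\<forall>u\<in>U. v u e = 0")
    case True
    have "card E < card U" using insert by simp
    from insert.IH[OF insert.prems(1) this, of v] obtain x where
      "\<exists>u\<in>U. x u \<noteq> 0" "\<forall>f\<in>E. (\<Sum>u\<in>U. x u * v u f) = 0" by blast
    with True show ?thesis by (intro exI[of _ x]) auto
  next
    case False
    then obtain u0 where u0: "u0 \<in> U" "v u0 e \<noteq> 0" by blast
    define V where "V = U - {u0}"
    have finV: "finite V" and U: "U = insert u0 V" and nV: "u0 \<notin> V"
      using insert.prems u0 by (auto simp: V_def)
    have "card E < card V" using insert.prems insert.hyps u0 by (simp add: V_def)
    from insert.IH[OF finV this, of "\<lambda>u f. v u f - v u e / v u0 e * v u0 f"] obtain x where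
      x: "\<exists>u\<in>V. x u \<noteq> 0"
      "\<forall>f\<in>E. (\<Sum>u\<in>V. x u * (v u f - v u e / v u0 e * v u0 f)) = 0" by blast
    define y where "y = (\<lambda>u. if u = u0 then - (\<Sum>u\<in>V. x u * v u e) / v u0 e else x u)"
    have sum_y: "(\<Sum>u\<in>U. y u * v u f) = y u0 * v u0 f + (\<Sum>u\<in>V. x u * v u f)" for f
    proof -
      have "(\<Sum>u\<in>V. y u * v u f) = (\<Sum>u\<in>V. x u * v u f)"
        by (rule sum.cong) (use nV in \<open>auto simp: y_def\<close>)
      then show ?thesis using finV nV by (simp add: U)
    qed
    have "(\<Sum>u\<in>U. y u * v u e) = 0" using u0 unfolding sum_y by (simp add: y_def)
    moreover have "(\<Sum>u\<in>U. y u * v u f) = 0" if "f \<in> E" for f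
    proof -
      have "(\<Sum>u\<in>V. x u * (v u f - v u e / v u0 e * v u0 f))
         = (\<Sum>u\<in>V. x u * v u f) - (\<Sum>u\<in>V. x u * v u e) / v u0 e * v u0 f"
        by (simp add: right_diff_distrib sum_subtractf sum_distrib_right sum_divide_distrib mult.assoc)
      then show ?thesis using x(2) that unfolding sum_y by (simp add: y_def)
    qed
    moreover have "\<exists>u\<in>U. y u \<noteq> 0" using x(1) nV by (auto simp: U y_def)
    ultimately show ?thesis by (intro exI[of _ y]) auto
  qed
qed

section \<open>Bidegree\<close>

text \<open>In \<open>'a poly poly\<close> the inner variable is \<open>X\<close> and the outer one is \<open>Y\<close>.\<close>

definition bideg_le :: "nat \<Rightarrow> nat \<Rightarrow> 'a::zero poly poly \<Rightarrow> bool" where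
  "bideg_le M N f \<longleftrightarrow> degree f \<le> N \<and> (\<forall>j. degree (coeff f j) \<le> M)"

abbreviation bmon :: "nat \<Rightarrow> nat \<Rightarrow> 'a::comm_semiring_1 poly poly" where
  "bmon i j \<equiv> monom (monom 1 i) j"

lemma bideg_leI:
  "(\<And>i j. coeff (coeff f j) i \<noteq> 0 \<Longrightarrow> i \<le> M \<and> j \<le> N) \<Longrightarrow> bideg_le M N f"
  unfolding bideg_le_def by (metis coeff_0 degree_le leD leading_coeff_0_iff linorder_le_less_linear)

lemma bideg_leD: "bideg_le M N f \<Longrightarrow> coeff (coeff f j) i \<noteq> 0 \<Longrightarrow> i \<le> M \<and> j \<le> N"
  unfolding bideg_le_def by (metis coeff_0 le_degree order_trans)

lemma bideg_le_mono: "bideg_le M N f \<Longrightarrow> M \<le> M' \<Longrightarrow> N \<le> N' \<Longrightarrow> bideg_le M' N' f"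
  unfolding bideg_le_def by (meson order_trans)

lemma bideg_le_0 [simp]: "bideg_le M N 0"
  by (simp add: bideg_le_def)

lemma bideg_le_add:
  "bideg_le M N f \<Longrightarrow> bideg_le M N g \<Longrightarrow> bideg_le M N (f + g)"
  by (auto simp: bideg_le_def intro: degree_add_le)

lemma bideg_le_diff:
  "bideg_le M N (f::'a::ab_group_add poly poly) \<Longrightarrow> bideg_le M N g \<Longrightarrow> bideg_le M N (f - g)"
  by (auto simp: bideg_le_def intro: degree_diff_le)

lemma bideg_le_sum:
  "(\<And>x. x \<in> A \<Longrightarrow> bideg_le M N (f x)) \<Longrightarrow> bideg_le M N (sum f A)"
  by (induction A rule: infinite_finite_induct) (auto intro: bideg_le_add)

lemma bideg_le_mult:
  assumes "bideg_le M N f" "bideg_le M' N' g"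
  shows "bideg_le (M + M') (N + N') (f * (g::'a::comm_semiring_0 poly poly))"
  unfolding bideg_le_def
proof (intro conjI allI)
  show "degree (f * g) \<le> N + N'"
    using assms degree_mult_le[of f g] unfolding bideg_le_def by linarith
  have "degree (coeff f i * coeff g (j - i)) \<le> M + M'" for i j
    using assms degree_mult_le[of "coeff f i" "coeff g (j - i)"] unfolding bideg_le_def
    by (meson add_mono order_trans)
  then show "degree (coeff (f * g) j) \<le> M + M'" for j
    by (simp add: coeff_mult degree_sum_le)
qed

lemma bideg_le_bmon: "bideg_le M N (bmon i j)" if "i \<le> M" "j \<le> N"
  using that by (intro bideg_leI) (auto split: if_splits)

lemma bideg_le_const: "bideg_le 0 0 [:[:c:]:]"
  by (intro bideg_leI) (auto simp: coeff_pCons split: nat.splits)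

lemma bideg_le_smult:
  "bideg_le M N f \<Longrightarrow> bideg_le M N (smult [:c:] (f::'a::comm_semiring_0 poly poly))"
  by (rule bideg_leI, rule bideg_leD[of M N f]) auto

lemma bideg_le_ex: "\<exists>d. bideg_le d d f"
proof -
  define d where "d = degree f + (\<Sum>j\<le>degree f. degree (coeff f j))"
  have "degree (coeff f j) \<le> d" for j
  proof (cases "j \<le> degree f")
    case True
    then have "degree (coeff f j) \<le> (\<Sum>j\<le>degree f. degree (coeff f j))"
      by (intro member_le_sum) auto
    then show ?thesis by (simp add: d_def)
  qed (simp add: coeff_eq_0)
  then show ?thesis by (intro exI[of _ d]) (auto simp: bideg_le_def d_def)
qed

lemma bideg_le_family: "finite J \<Longrightarrow> \<exists>d. \<forall>j\<in>J. bideg_le d d (F j)"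
proof (induction J rule: finite_induct)
  case (insert x J)
  then obtain d where "\<forall>j\<in>J. bideg_le d d (F j)" by blast
  moreover obtain e where "bideg_le e e (F x)" using bideg_le_ex by blast
  ultimately show ?case by (intro exI[of _ "max d e"]) (auto intro: bideg_le_mono)
qed auto

lemma coeff_mult_top:
  assumes "degree p \<le> a" "degree q \<le> b"
  shows "coeff (p * q) (a + b) = coeff p a * coeff q b"
proof -
  have "coeff (p * q) (a + b) = (\<Sum>i\<le>a + b. coeff p i * coeff q (a + b - i))"
    by (simp add: coeff_mult)
  also have "\<dots> = (\<Sum>i\<in>{a}. coeff p i * coeff q (a + b - i))"
  proof (rule sum.mono_neutral_right)
    show "\<forall>i\<in>{..a + b} - {a}. coeff p i * coeff q (a + b - i) = 0"
    proof
      fix i assume "i \<in> {..a + b} - {a}"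
      then consider "i > a" | "a + b - i > b" by fastforce
      then show "coeff p i * coeff q (a + b - i) = 0"
        using assms by cases (simp_all add: coeff_eq_0)
    qed
  qed auto
  finally show ?thesis by simp
qed

text \<open>Degrees in \<open>X\<close> are additive because the leading coefficients with respect to \<open>X\<close>,
  which are polynomials in \<open>Y\<close>, multiply. If \<open>(m, n)\<close> is the exact bidegree of \<open>P\<close>, a cofactor of
  \<open>P\<close> therefore takes up only what remains of the bidegree.\<close>

lemma bideg_le_cofactor:
  fixes P Q :: "'a::idom poly poly"
  assumes "bideg_le m n P" "coeff (coeff P j0) m \<noteq> 0" "degree P = n"
    and "bideg_le (m + M) (n + N) (P * Q)"
  shows "bideg_le M N Q"
proof (cases "Q = 0")
  case False
  define d where "d = Max ((\<lambda>j. degree (coeff Q j)) ` {..degree Q})"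
  have d: "degree (coeff Q j) \<le> d" for j
  proof (cases "j \<le> degree Q")
    case True
    then show ?thesis by (auto simp: d_def)
  qed (simp add: coeff_eq_0)
  have "d \<in> (\<lambda>j. degree (coeff Q j)) ` {..degree Q}"
    unfolding d_def by (rule Max_in) auto
  then obtain j1 where j1: "d = degree (coeff Q j1)" by auto
  have "\<exists>j. coeff (coeff Q j) d \<noteq> 0"
  proof (cases "coeff Q j1 = 0")
    case True
    then have "d = 0" using j1 by simp
    moreover have "degree (lead_coeff Q) \<le> d" by (rule d)
    ultimately show ?thesis using False by (metis leading_coeff_0_iff le_zero_eq)
  qed (metis j1 leading_coeff_0_iff)
  then obtain j2 where j2: "coeff (coeff Q j2) d \<noteq> 0" by blast
  \<comment> \<open>the leading coefficients with respect to \<open>X\<close>\<close>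
  define tP where "tP = map_poly (\<lambda>c. coeff c m) P"
  define tQ where "tQ = map_poly (\<lambda>c. coeff c d) Q"
  have "tP \<noteq> 0" using assms(2) by (metis coeff_0 coeff_map_poly tP_def)
  moreover have "tQ \<noteq> 0" using j2 by (metis coeff_0 coeff_map_poly tQ_def)
  ultimately have "tP * tQ \<noteq> 0" by simp
  then obtain k where k: "coeff (tP * tQ) k \<noteq> 0" by (metis leading_coeff_0_iff)
  have "coeff (tP * tQ) k = coeff (coeff (P * Q) k) (m + d)"
    using assms(1) d
    by (simp add: coeff_mult[of _ _ k] coeff_sum coeff_map_poly tP_def tQ_def coeff_mult_top
        bideg_le_def)
  with k have "m + d \<le> m + M" using bideg_leD[OF assms(4)] by metis
  then have "degree (coeff Q j) \<le> M" for j using d[of j] by simp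
  moreover have "degree Q \<le> N"
  proof -
    have "P \<noteq> 0" using assms(2) by auto
    then have "degree (P * Q) = n + degree Q" using False assms(3) by (simp add: degree_mult_eq)
    then show ?thesis using assms(4) by (simp add: bideg_le_def)
  qed
  ultimately show ?thesis by (simp add: bideg_le_def)
qed simp

text \<open>Each polynomial identity amounts to one scalar equation per monomial in its box of
  exponents, so several identities can be met at once as soon as the unknowns outnumber the monomials.\<close>

lemma bivariate_relation:
  fixes F :: "'u \<Rightarrow> 'w \<Rightarrow> 'a::field poly poly"
  assumes "finite U" "finite W"
    and F: "\<And>u w. u \<in> U \<Longrightarrow> w \<in> W \<Longrightarrow> bideg_le (M w) (N w) (F u w)"
    and card: "(\<Sum>w\<in>W. Suc (M w) * Suc (N w)) < card U"
  shows "\<exists>x. (\<exists>u\<in>U. x u \<noteq> 0) \<and> (\<forall>w\<in>W. (\<Sum>u\<in>U. smult [:x u:] (F u w)) = 0)"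
proof -
  define E where "E = Sigma W (\<lambda>w. {..M w} \<times> {..N w})"
  have "finite E" "card E = (\<Sum>w\<in>W. Suc (M w) * Suc (N w))"
    using assms(2) by (auto simp: E_def card_SigmaI)
  with card nontrivial_relation[OF assms(1), of E "\<lambda>u (w, i, j). coeff (coeff (F u w) j) i"]
  obtain x where x: "\<exists>u\<in>U. x u \<noteq> 0"
      "\<forall>e\<in>E. (\<Sum>u\<in>U. x u * (case e of (w, i, j) \<Rightarrow> coeff (coeff (F u w) j) i)) = 0"
    by auto
  have "(\<Sum>u\<in>U. smult [:x u:] (F u w)) = 0" if w: "w \<in> W" for w
  proof -
    have "coeff (coeff (\<Sum>u\<in>U. smult [:x u:] (F u w)) j) i = 0" for i j
    proof (cases "i \<le> M w \<and> j \<le> N w")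
      case True
      then have "(w, i, j) \<in> E" using w by (simp add: E_def)
      with x(2) show ?thesis by (auto simp: coeff_sum)
    next
      case False
      then have "coeff (coeff (F u w) j) i = 0" if "u \<in> U" for u
        using bideg_leD[OF F[OF that w]] by blast
      then show ?thesis by (simp add: coeff_sum)
    qed
    then show ?thesis by (simp add: poly_eq_iff)
  qed
  with x(1) show ?thesis by blast
qed

section \<open>Derivations and orders of vanishing\<close>

text \<open>Orders of vanishing are measured by iterating a derivation and evaluating. For a
  derivation along a curve this is the order of contact with the curve at the point.\<close>

locale derivation_at =
  fixes \<delta> :: "'r::comm_ring_1 \<Rightarrow> 'r" and ev :: "'r \<Rightarrow> 'a::idom"
  assumes \<delta>_add: "\<delta> (f + g) = \<delta> f + \<delta> g"
    and \<delta>_mult: "\<delta> (f * g) = \<delta> f * g + f * \<delta> g"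
    and ev_add: "ev (f + g) = ev f + ev g"
    and ev_mult: "ev (f * g) = ev f * ev g"
begin

definition vanishes :: "nat \<Rightarrow> 'r \<Rightarrow> bool" where
  "vanishes k f \<longleftrightarrow> (\<forall>j<k. ev ((\<delta> ^^ j) f) = 0)"

lemma vanishes_0 [simp]: "vanishes 0 f"
  by (simp add: vanishes_def)

lemma vanishes_Suc: "vanishes (Suc k) f \<longleftrightarrow> ev f = 0 \<and> vanishes k (\<delta> f)"
  unfolding vanishes_def by (auto simp: less_Suc_eq_0_disj funpow_Suc_right simp del: funpow.simps(2))

lemma vanishes_mono: "vanishes k f \<Longrightarrow> l \<le> k \<Longrightarrow> vanishes l f"
  by (auto simp: vanishes_def)

lemma \<delta>_0: "\<delta> 0 = 0"
  using \<delta>_add[of 0 0] by simp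

lemma ev_0: "ev 0 = 0"
  using ev_add[of 0 0] by (metis add_cancel_right_left)

lemma \<delta>_1: "\<delta> 1 = 0"
  using \<delta>_mult[of 1 1] by (metis add_cancel_right_left mult_1 mult_1_right)

lemma vanishes_zero [simp]: "vanishes k 0"
  by (induction k) (simp_all add: vanishes_Suc \<delta>_0 ev_0)

lemma vanishes_add: "vanishes k f \<Longrightarrow> vanishes k g \<Longrightarrow> vanishes k (f + g)"
  by (induction k arbitrary: f g) (auto simp: vanishes_Suc \<delta>_add ev_add)

lemma vanishes_sum: "(\<And>x. x \<in> A \<Longrightarrow> vanishes k (f x)) \<Longrightarrow> vanishes k (sum f A)"
  by (induction A rule: infinite_finite_induct) (auto intro: vanishes_add)

lemma vanishes_mult_right: "vanishes k f \<Longrightarrow> vanishes k (f * g)"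
proof (induction k arbitrary: f g)
  case (Suc k)
  have "vanishes k f" using Suc.prems by (rule vanishes_mono) simp
  moreover have "ev f = 0" "vanishes k (\<delta> f)" using Suc.prems by (simp_all add: vanishes_Suc)
  ultimately have "vanishes k (\<delta> f * g + f * \<delta> g)"
    by (intro vanishes_add Suc.IH)
  then show ?case using \<open>ev f = 0\<close> by (simp add: vanishes_Suc \<delta>_mult ev_mult)
qed simp

text \<open>By the Leibniz rule, with one derivative taken off either factor, orders add.\<close>

lemma vanishes_mult: "vanishes a f \<Longrightarrow> vanishes b g \<Longrightarrow> vanishes (a + b) (f * g)"
proof (induction "a + b" arbitrary: a b f g)
  case (Suc k)
  show ?case
  proof (cases "a = 0 \<or> b = 0")
    case True
    then show ?thesis using Suc.prems vanishes_mult_right[of b g f] vanishes_mult_right[of a f g]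
      by (auto simp: mult.commute)
  next
    case False
    then obtain a' b' where ab: "a = Suc a'" "b = Suc b'" by (meson not0_implies_Suc)
    have "vanishes (a' + b) (\<delta> f * g)"
      by (rule Suc.hyps(1)) (use Suc ab in \<open>auto simp: vanishes_Suc\<close>)
    moreover have "vanishes (a + b') (f * \<delta> g)"
      by (rule Suc.hyps(1)) (use Suc ab in \<open>auto simp: vanishes_Suc\<close>)
    ultimately have "vanishes (a' + b) (\<delta> (f * g))"
      unfolding \<delta>_mult by (intro vanishes_add) (simp_all add: ab)
    moreover have "ev (f * g) = 0" using Suc.prems by (simp add: ab vanishes_Suc ev_mult)
    ultimately show ?thesis by (simp add: ab vanishes_Suc)
  qed
qed simp

lemma vanishes_power: "ev f = 0 \<Longrightarrow> vanishes k (f ^ k)"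
proof (induction k)
  case (Suc k)
  then have "vanishes (1 + k) (f * f ^ k)"
    by (intro vanishes_mult) (auto simp: vanishes_def)
  then show ?case by simp
qed simp

lemma \<delta>_power: "\<delta> (f ^ Suc k) = of_nat (Suc k) * f ^ k * \<delta> f"
  by (induction k) (simp_all add: \<delta>_mult \<delta>_1 algebra_simps)

lemma ev_of_nat_mult: "ev (of_nat k * f) = of_nat k * ev f"
  by (induction k) (simp_all add: ev_0 ev_add algebra_simps)

text \<open>If \<open>f\<close> vanishes at the point, the first derivative of \<open>f ^ k * g\<close> that can be nonzero there is
  the \<open>k\<close>-th, and it is the product of the leading terms. The factor \<open>k!\<close> is the reason for
  the restriction of the order \<open>D\<close> by the characteristic.\<close>

lemma derivative_power_mult:
  assumes "ev f = 0"
  shows "ev ((\<delta> ^^ k) (f ^ k * g)) = of_nat (fact k) * ev (\<delta> f) ^ k * ev g"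
proof (induction k arbitrary: g)
  case (Suc k)
  have "\<delta> (f ^ Suc k * g) = f ^ k * (of_nat (Suc k) * (\<delta> f * g) + f * \<delta> g)"
    unfolding \<delta>_mult \<delta>_power by (simp add: algebra_simps)
  then have "ev ((\<delta> ^^ Suc k) (f ^ Suc k * g))
      = ev ((\<delta> ^^ k) (f ^ k * (of_nat (Suc k) * (\<delta> f * g) + f * \<delta> g)))"
    by (simp add: funpow_Suc_right del: funpow.simps power_Suc of_nat_Suc)
  also have "\<dots> = of_nat (fact k) * ev (\<delta> f) ^ k * (of_nat (Suc k) * (ev (\<delta> f) * ev g))"
    unfolding Suc.IH ev_add ev_of_nat_mult by (simp add: ev_mult assms)
  finally show ?case by (simp add: algebra_simps)
qed simp

end

section \<open>Euler operators\<close>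

text \<open>The operators \<open>X \<partial>/\<partial>X\<close> and \<open>Y \<partial>/\<partial>Y\<close>. They multiply the coefficient of \<open>X^i Y^j\<close> by \<open>i\<close> and
  by \<open>j\<close>, so monomials are eigenvectors and bidegrees do not grow.\<close>

definition euler_X :: "'a::field poly poly \<Rightarrow> 'a poly poly" where
  "euler_X f = map_poly (\<lambda>c. pCons 0 (pderiv c)) f"

definition euler_Y :: "'a::field poly poly \<Rightarrow> 'a poly poly" where
  "euler_Y f = pCons 0 (pderiv f)"

lemma coeff_euler_X: "coeff (euler_X f) j = pCons 0 (pderiv (coeff f j))"
  by (simp add: euler_X_def coeff_map_poly)

lemma coeff_coeff_euler_X: "coeff (coeff (euler_X f) j) i = of_nat i * coeff (coeff f j) i"
  by (cases i) (simp_all add: coeff_euler_X coeff_pCons coeff_pderiv)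

lemma coeff_coeff_euler_Y: "coeff (coeff (euler_Y f) j) i = of_nat j * coeff (coeff f j) i"
proof (cases j)
  case (Suc k)
  have "of_nat (Suc k) * coeff f (Suc k) = smult (of_nat (Suc k)) (coeff f (Suc k))"
    by (simp add: of_nat_poly del: of_nat_Suc)
  then show ?thesis by (simp add: Suc euler_Y_def coeff_pderiv del: of_nat_Suc)
qed (simp add: euler_Y_def)

lemma euler_X_add: "euler_X (f + g) = euler_X f + euler_X g"
  by (simp add: poly_eq_iff coeff_coeff_euler_X algebra_simps)

lemma euler_Y_add: "euler_Y (f + g) = euler_Y f + euler_Y g"
  by (simp add: euler_Y_def pderiv_add)

lemma euler_X_mult: "euler_X (f * g) = euler_X f * g + f * euler_X g"
proof -
  define d where "d c = pCons 0 (pderiv c)" for c :: "'a poly"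
  have d_mult: "d (a * b) = d a * b + a * d b" for a b
    by (simp add: d_def pderiv_mult algebra_simps)
  have d_sum: "d (sum h A) = (\<Sum>x\<in>A. d (h x))" for h :: "nat \<Rightarrow> 'a poly" and A
    unfolding d_def
    by (rule poly_eqI)
       (auto simp: coeff_pCons coeff_pderiv coeff_sum sum_distrib_left split: nat.split)
  have coeff_d: "coeff (euler_X h) j = d (coeff h j)" for h j
    by (simp add: coeff_euler_X d_def)
  show ?thesis
    by (rule poly_eqI) (simp add: coeff_d coeff_mult d_mult d_sum sum.distrib)
qed

lemma euler_Y_mult: "euler_Y (f * g) = euler_Y f * g + f * euler_Y g"
  by (simp add: euler_Y_def pderiv_mult algebra_simps)

lemma bideg_le_euler_X: "bideg_le M N f \<Longrightarrow> bideg_le M N (euler_X f)"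
  by (rule bideg_leI) (auto simp: coeff_coeff_euler_X dest: bideg_leD)

lemma bideg_le_euler_Y: "bideg_le M N f \<Longrightarrow> bideg_le M N (euler_Y f)"
  by (rule bideg_leI) (auto simp: coeff_coeff_euler_Y dest: bideg_leD)

text \<open>This is \<open>XY\<close> times the Hamiltonian derivation of \<open>P\<close>. It kills \<open>P\<close>, hence it preserves the ideal
  of the curve \<open>P = 0\<close> and differentiates along it.\<close>

definition curve_der :: "'a::field poly poly \<Rightarrow> 'a poly poly \<Rightarrow> 'a poly poly" where
  "curve_der P f = euler_Y P * euler_X f - euler_X P * euler_Y f"

definition eval_at :: "'a \<times> 'a \<Rightarrow> 'a::comm_ring_1 poly poly \<Rightarrow> 'a" where
  "eval_at q f = poly (poly f [:snd q:]) (fst q)"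

lemma curve_der_add: "curve_der P (f + g) = curve_der P f + curve_der P g"
  by (simp add: curve_der_def euler_X_add euler_Y_add algebra_simps)

lemma curve_der_mult: "curve_der P (f * g) = curve_der P f * g + f * curve_der P g"
  by (simp add: curve_der_def euler_X_mult euler_Y_mult algebra_simps)

lemma curve_der_self: "curve_der P P = 0"
  by (simp add: curve_der_def algebra_simps)

lemma eval_at_simps:
  "eval_at q (f + g) = eval_at q f + eval_at q g"
  "eval_at q (f * g) = eval_at q f * eval_at q g"
  "eval_at q (f - g) = eval_at q f - eval_at q g"
  "eval_at q 0 = 0" "eval_at q 1 = 1"
  "eval_at q (f ^ k) = eval_at q f ^ k"
  "eval_at q (smult [:c:] f) = c * eval_at q f"
  by (simp_all add: eval_at_def)

lemma eval_at_sum: "eval_at q (sum f A) = (\<Sum>x\<in>A. eval_at q (f x))"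
  by (simp add: eval_at_def poly_sum)

lemma eval_at_prod: "eval_at q (prod f A) = (\<Prod>x\<in>A. eval_at q (f x))"
  by (simp add: eval_at_def poly_prod)

lemma eval_at_bmon: "eval_at (x, y) (bmon i j) = x ^ i * y ^ j"
  by (simp add: eval_at_def poly_monom algebra_simps poly_power)

lemma derivation_at_curve: "derivation_at (curve_der P) (eval_at q)"
  by unfold_locales (simp_all add: curve_der_add curve_der_mult eval_at_simps)

lemma bideg_le_curve_der:
  assumes "bideg_le m n P" "bideg_le M N f"
  shows "bideg_le (m + M) (n + N) (curve_der P f)"
  unfolding curve_der_def
  by (intro bideg_le_diff bideg_le_mult bideg_le_euler_X bideg_le_euler_Y assms)

section \<open>Intersection numbers by counting coefficients\<close>

lemma coeff_bmon_combination:
  assumes "finite S"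
  shows "coeff (coeff (\<Sum>s\<in>S. smult [:x s:] (bmon (fst s) (snd s))) l) k
    = (if (k, l) \<in> S then x (k, l) else (0::'a::field))"
proof -
  have "coeff (coeff (\<Sum>s\<in>S. smult [:x s:] (bmon (fst s) (snd s))) l) k
      = (\<Sum>s\<in>S. if s = (k, l) then x s else 0)"
    unfolding coeff_sum by (rule sum.cong) (auto simp: prod_eq_iff)
  then show ?thesis using assms by simp
qed

text \<open>A form of Bezout's theorem: \<open>K[X, Y]\<close> modulo two coprime polynomials of bidegrees \<open>(m, n)\<close> and
  \<open>(e, f)\<close> has dimension at most \<open>mf + ne\<close>. All polynomials in question fit in one large box of
  exponents, where a count of coefficients produces a relation
  \<open>(\<Sum>j. c\<^sub>j I\<^sub>j) + P S\<^sub>1 + \<Psi> S\<^sub>2 = 0\<close>. To exclude the trivial relations among the multiples of \<open>P\<close>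
  and of \<open>\<Psi>\<close>, the monomials of \<open>S\<^sub>2\<close> avoid a rectangle that contains the leading monomial of every
  multiple of \<open>P\<close> in the box. Then \<open>P dvd S\<^sub>2\<close> forces \<open>S\<^sub>2 = 0\<close>.\<close>

lemma independent_family_card_le:
  fixes P \<Psi> :: "'a::field poly poly" and I :: "'j \<Rightarrow> 'a poly poly"
  assumes prime: "prime_elem P"
    and P: "bideg_le m n P" "coeff (coeff P j0) m \<noteq> 0" "degree P = n"
    and \<Psi>: "bideg_le e f \<Psi>" "\<not> P dvd \<Psi>"
    and J: "finite J"
    and indep: "\<And>c Q1 Q2. (\<Sum>j\<in>J. smult [:c j:] (I j)) = P * Q1 + \<Psi> * Q2 \<Longrightarrow> \<forall>j\<in>J. c j = 0"
  shows "card J \<le> m * f + n * e"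
proof (rule ccontr)
  assume "\<not> card J \<le> m * f + n * e"
  then have cardJ: "m * f + n * e < card J" by simp
  obtain d where d: "\<forall>j\<in>J. bideg_le d d (I j)" using bideg_le_family[OF J] by blast
  define i0 where "i0 = degree (lead_coeff P)"
  have i0: "i0 \<le> m" using P(1) by (simp add: i0_def bideg_le_def)
  have P0: "P \<noteq> 0" using P(2) by auto
  \<comment> \<open>with the box \<open>{..m + e + d} \<times> {..n + f + d}\<close>: \<open>A\<close> holds the exponents of \<open>S1\<close>, and \<open>R\<close> those
    of \<open>S2\<close>, from which the rectangle \<open>B\<close> of possible leading monomials has been removed\<close>
  define A where "A = {..e + d} \<times> {..f + d}"
  define B where "B = {i0..i0 + d} \<times> {n..n + d}"
  define R where "R = {..m + d} \<times> {..n + d} - B"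
  have fin: "finite A" "finite B" "finite R" by (auto simp: A_def B_def R_def)
  have "B \<subseteq> {..m + d} \<times> {..n + d}" using i0 by (auto simp: B_def)
  then have "card R + card B = card ({..m + d} \<times> {..n + d})"
    unfolding R_def using fin(2) by (metis Sigma_mono card_Diff_subset card_mono finite_SigmaI
      finite_atMost le_add_diff_inverse2)
  then have cardR: "card R + Suc d * Suc d = Suc (m + d) * Suc (n + d)"
    by (simp add: B_def)
  have cardA: "card A = Suc (e + d) * Suc (f + d)" by (simp add: A_def)
  define F where "F u (w::unit) = (case u of Inl j \<Rightarrow> I j
      | Inr (Inl s) \<Rightarrow> P * bmon (fst s) (snd s) | Inr (Inr s) \<Rightarrow> \<Psi> * bmon (fst s) (snd s))"
    for u :: "'j + (nat \<times> nat) + (nat \<times> nat)" and w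
  define U where "U = J <+> (A <+> R)"
  have "\<exists>x. (\<exists>u\<in>U. x u \<noteq> 0) \<and> (\<forall>w\<in>{()}. (\<Sum>u\<in>U. smult [:x u:] (F u w)) = 0)"
  proof (rule bivariate_relation)
    show "finite U" using J fin by (auto simp: U_def)
    have "card U = card J + (card A + card R)"
      using J fin by (simp add: U_def card_Plus)
    moreover have "Suc (m + e + d) * Suc (n + f + d) + Suc d * Suc d
        = Suc (e + d) * Suc (f + d) + Suc (m + d) * Suc (n + d) + (m * f + n * e)"
      by (simp add: algebra_simps)
    ultimately show "(\<Sum>w\<in>{()}. Suc (m + e + d) * Suc (n + f + d)) < card U"
      using cardJ cardA cardR by simp
    fix u and w :: unit assume "u \<in> U"
    then consider (1) j where "j \<in> J" "u = Inl j"
      | (2) s where "s \<in> A" "u = Inr (Inl s)" | (3) s where "s \<in> R" "u = Inr (Inr s)"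
      by (auto simp: U_def Plus_def)
    then show "bideg_le (m + e + d) (n + f + d) (F u w)"
    proof cases
      case 1
      with d show ?thesis by (auto simp: F_def intro: bideg_le_mono)
    next
      case 2
      have "bideg_le (e + d) (f + d) (bmon (fst s) (snd s) :: 'a poly poly)"
        by (rule bideg_le_bmon) (use 2 in \<open>auto simp: A_def\<close>)
      from bideg_le_mult[OF P(1) this] 2 show ?thesis by (simp add: F_def add.assoc)
    next
      case 3
      have "bideg_le (m + d) (n + d) (bmon (fst s) (snd s) :: 'a poly poly)"
        by (rule bideg_le_bmon) (use 3 in \<open>auto simp: R_def\<close>)
      from bideg_le_mult[OF \<Psi>(1) this] 3 show ?thesis
        by (simp add: F_def algebra_simps)
    qed
  qed simp
  then obtain x where x: "\<exists>u\<in>U. x u \<noteq> 0" "(\<Sum>u\<in>U. smult [:x u:] (F u ())) = 0" by blast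
  define c where "c j = x (Inl j)" for j
  define S1 where "S1 = (\<Sum>s\<in>A. smult [:x (Inr (Inl s)):] (bmon (fst s) (snd s)))"
  define S2 where "S2 = (\<Sum>s\<in>R. smult [:x (Inr (Inr s)):] (bmon (fst s) (snd s)))"
  have "(\<Sum>u\<in>U. smult [:x u:] (F u ())) = (\<Sum>j\<in>J. smult [:c j:] (I j)) + (P * S1 + \<Psi> * S2)"
    unfolding U_def using J fin
    by (simp add: sum.Plus F_def c_def S1_def S2_def sum_distrib_left)
  with x(2) have rel: "(\<Sum>j\<in>J. smult [:c j:] (I j)) + (P * S1 + \<Psi> * S2) = 0" by simp
  then have "(\<Sum>j\<in>J. smult [:c j:] (I j)) = P * (- S1) + \<Psi> * (- S2)"
    by (simp add: add_eq_0_iff2)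
  then have c0: "\<forall>j\<in>J. c j = 0" by (rule indep)
  then have rel2: "P * S1 + \<Psi> * S2 = 0" using rel by simp
  then have "P dvd \<Psi> * S2" by (metis add_eq_0_iff dvd_minus_iff dvd_triv_left)
  then have "P dvd S2" using prime \<Psi>(2) by (simp add: prime_elem_dvd_mult_iff)
  then obtain T where T: "S2 = P * T" by blast
  have S2_coeff: "coeff (coeff S2 l) k = (if (k, l) \<in> R then x (Inr (Inr (k, l))) else 0)" for k l
    unfolding S2_def using coeff_bmon_combination[OF fin(3)] .
  have "T = 0"
  proof (rule ccontr)
    assume "T \<noteq> 0"
    have "bideg_le (m + d) (n + d) (P * T)"
      unfolding T[symmetric] by (rule bideg_leI) (auto simp: S2_coeff R_def split: if_splits)
    then have bT: "bideg_le d d T" using bideg_le_cofactor[OF P] by blast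
    \<comment> \<open>the lexicographically leading monomial of \<open>P * T\<close> lies in the removed rectangle\<close>
    define k where "k = i0 + degree (lead_coeff T)"
    define l where "l = n + degree T"
    have "coeff S2 l = lead_coeff P * lead_coeff T"
      unfolding T l_def using P(3) coeff_mult_degree_sum by blast
    then have "coeff (coeff S2 l) k = lead_coeff (lead_coeff P) * lead_coeff (lead_coeff T)"
      by (simp add: k_def i0_def coeff_mult_degree_sum)
    then have "coeff (coeff S2 l) k \<noteq> 0" using P0 \<open>T \<noteq> 0\<close> by simp
    moreover have "(k, l) \<in> B"
      using bT by (auto simp: B_def k_def l_def bideg_le_def)
    ultimately show False by (auto simp: S2_coeff R_def split: if_splits)
  qed
  then have S2: "S2 = 0" using T by simp
  then have "S1 = 0" using rel2 P0 by simp
  have "x u = 0" if "u \<in> U" for u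
  proof -
    from that consider (1) j where "j \<in> J" "u = Inl j"
      | (2) k l where "(k, l) \<in> A" "u = Inr (Inl (k, l))"
      | (3) k l where "(k, l) \<in> R" "u = Inr (Inr (k, l))"
      by (auto simp: U_def Plus_def)
    then show ?thesis
    proof cases
      case 1
      with c0 show ?thesis by (simp add: c_def)
    next
      case 2
      have "coeff (coeff S1 l) k = x (Inr (Inl (k, l)))"
        unfolding S1_def using coeff_bmon_combination[OF fin(1), of "\<lambda>s. x (Inr (Inl s))"] 2(1) by simp
      with 2 \<open>S1 = 0\<close> show ?thesis by simp
    next
      case 3
      with S2_coeff[of l k] S2 show ?thesis by simp
    qed
  qed
  with x(1) show False by blast
qed

text \<open>Bezout's theorem for points where \<open>\<Psi>\<close> has contact of order \<open>D\<close> with the curve. The family for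
  the count is \<open>(X - x\<^sub>q) ^ k\<close> with \<open>q \<in> S\<close> and \<open>k < D\<close>, multiplied by a polynomial that vanishes to
  order \<open>D\<close> at the other points and not at \<open>q\<close>. Both \<open>P\<close> and \<open>\<Psi>\<close> vanish to order \<open>D\<close> along the curve
  at each \<open>q\<close>, so looking at derivatives at \<open>q\<close> of increasing order kills the coefficients one
  after another. The last hypothesis says that \<open>X - x\<^sub>q\<close> is a local parameter at \<open>q\<close> and that
  \<open>k!\<close> is nonzero; it holds trivially for \<open>D = 1\<close>, so that all common zeros are counted, singular
  points of the curve included.\<close>

lemma contact_order_bound:
  fixes P \<Psi> :: "'a::field poly poly" and S :: "('a \<times> 'a) set"
  assumes prime: "prime_elem P"
    and P: "bideg_le m n P" "coeff (coeff P j0) m \<noteq> 0" "degree P = n"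
    and \<Psi>: "bideg_le e f \<Psi>" "\<not> P dvd \<Psi>"
    and S: "finite S" "\<And>q. q \<in> S \<Longrightarrow> eval_at q P = 0"
    and van: "\<And>q. q \<in> S \<Longrightarrow> derivation_at.vanishes (curve_der P) (eval_at q) D \<Psi>"
    and reg: "\<And>q k. q \<in> S \<Longrightarrow> k < D \<Longrightarrow>
      of_nat (fact k) * (fst q * eval_at q (euler_Y P)) ^ k \<noteq> 0"
  shows "D * card S \<le> m * f + n * e"
proof -
  define L :: "'a \<times> 'a \<Rightarrow> 'a poly poly" where "L q = [:[:- fst q, 1:]:]" for q
  define s :: "'a \<times> 'a \<Rightarrow> 'a \<times> 'a \<Rightarrow> 'a poly poly" where
    "s q r = (if fst q \<noteq> fst r then [:[:- fst r, 1:]:] else [:[:- snd r:], 1:])" for q r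
  define sep where "sep q = (\<Prod>r\<in>S - {q}. s q r)" for q
  define I where "I = (\<lambda>(q, k). L q ^ k * sep q ^ D)"
  have s_self: "eval_at q (s q r) \<noteq> 0" if "q \<noteq> r" for q r
    using that by (auto simp: s_def eval_at_def prod_eq_iff)
  have s_other: "eval_at r (s q r) = 0" for q r
    by (auto simp: s_def eval_at_def)
  have sep_self: "eval_at q (sep q) \<noteq> 0" for q
    using S(1) s_self[of q] by (auto simp: sep_def eval_at_prod simp del: split_paired_All)
  have sep_other: "eval_at r (sep q) = 0" if "r \<in> S" "r \<noteq> q" for q r
    using S(1) s_other[of r q] that by (auto simp: sep_def eval_at_prod intro!: bexI[of _ r])
  have L0: "eval_at q (L q) = 0" for q by (simp add: L_def eval_at_def)
  have derL: "eval_at q (curve_der P (L q)) = fst q * eval_at q (euler_Y P)" for q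
  proof -
    have "euler_X (L q) = [:[:0, 1:]:]" "euler_Y (L q) = 0"
      by (simp_all add: L_def euler_X_def euler_Y_def map_poly_pCons pderiv_pCons)
    then show ?thesis by (simp add: curve_der_def eval_at_simps) (simp add: eval_at_def)
  qed
  have "card (S \<times> {..<D}) \<le> m * f + n * e"
  proof (rule independent_family_card_le[OF prime P \<Psi>])
    show "finite (S \<times> {..<D})" using S by simp
    fix c Q1 Q2
    assume rel: "(\<Sum>j\<in>S \<times> {..<D}. smult [:c j:] (I j)) = P * Q1 + \<Psi> * Q2"
    have "c (q, k) = 0" if "q \<in> S" "k < D" for q k
      using that
    proof (induction k rule: less_induct)
      case (less k)
      interpret q: derivation_at "curve_der P" "eval_at q" by (rule derivation_at_curve)
      have vP: "q.vanishes D P"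
        using S(2)[OF less(2)] less.prems
        by (cases D) (simp_all add: q.vanishes_Suc curve_der_self)
      have "q.vanishes D (P * Q1 + \<Psi> * Q2)"
        using vP van[OF less(2)] by (intro q.vanishes_add q.vanishes_mult_right)
      then have vD: "q.vanishes (Suc k) (P * Q1 + \<Psi> * Q2)"
        using less.prems(2) by (auto intro: q.vanishes_mono)
      have vI: "q.vanishes (Suc k) (smult [:c j:] (I j))"
        if "j \<in> S \<times> {..<D} - {(q, k)}" for j
      proof -
        obtain r l where jrl: "j = (r, l)" by (cases j)
        with that have j: "j = (r, l)" "r \<in> S" "l < D" "r \<noteq> q \<or> l \<noteq> k" by blast+
        have smult_eq: "smult [:c j:] (I j) = I j * [:[:c j:]:]" by simp
        consider "r \<noteq> q" | "r = q" "l < k" | "r = q" "l > k" using j by linarith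
        then show ?thesis
        proof cases
          case 1
          \<comment> \<open>a member that belongs to another point vanishes here because of its separating factor\<close>
          then have "q.vanishes D (sep r ^ D)"
            using sep_other[of q r] less.prems by (intro q.vanishes_power) auto
          then have "q.vanishes D (sep r ^ D * (L r ^ l * [:[:c j:]:]))"
            by (rule q.vanishes_mult_right)
          then have "q.vanishes D (smult [:c j:] (I j))"
            unfolding smult_eq by (simp add: I_def j algebra_simps)
          then show ?thesis using less.prems by (auto intro: q.vanishes_mono)
        next
          case 2
          then have "c j = 0" using less.IH[of l] less.prems j by auto
          then show ?thesis by simp
        next
          case 3
          have "q.vanishes l (L q ^ l)" by (rule q.vanishes_power) (rule L0)
          then have "q.vanishes l (L q ^ l * (sep q ^ D * [:[:c j:]:]))"
            by (rule q.vanishes_mult_right)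
          then have "q.vanishes l (smult [:c j:] (I j))"
            unfolding smult_eq using 3 by (simp add: I_def j algebra_simps)
          then show ?thesis using 3 by (auto intro: q.vanishes_mono)
        qed
      qed
      have "smult [:c (q, k):] (I (q, k)) = (P * Q1 + \<Psi> * Q2)
          + (\<Sum>j\<in>S \<times> {..<D} - {(q, k)}. smult [:c j:] (I j)) * (- 1)"
        unfolding rel[symmetric] using less.prems S(1)
        by (subst sum.remove[of "S \<times> {..<D}" "(q, k)"]) auto
      also have "q.vanishes (Suc k) \<dots>"
        by (intro q.vanishes_add vD q.vanishes_mult_right q.vanishes_sum vI)
      finally have "eval_at q ((curve_der P ^^ k) (smult [:c (q, k):] (I (q, k)))) = 0"
        by (simp add: q.vanishes_def)
      moreover have "smult [:c (q, k):] (I (q, k)) = L q ^ k * (smult [:c (q, k):] (sep q ^ D))"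
        by (simp add: I_def)
      ultimately have "of_nat (fact k) * (fst q * eval_at q (euler_Y P)) ^ k
          * (c (q, k) * eval_at q (sep q) ^ D) = 0"
        using q.derivative_power_mult[OF L0, of k "smult [:c (q, k):] (sep q ^ D)"]
        by (simp add: derL eval_at_simps)
      then show ?case using reg[OF less.prems] sep_self[of q] by auto
    qed
    then show "\<forall>j\<in>S \<times> {..<D}. c j = 0" by auto
  qed
  then show ?thesis by (simp add: card_cartesian_product mult.commute)
qed

section \<open>The auxiliary polynomial\<close>

text \<open>The \<open>k\<close>-th derivative along the curve of the monomial \<open>X^a Y^b\<close>, divided by that monomial. Its
  bidegree \<open>(km, kn)\<close> does not depend on \<open>a\<close> and \<open>b\<close>, which may be close to \<open>p\<close>.\<close>

primrec monomial_jet :: "'a::field poly poly \<Rightarrow> nat \<Rightarrow> nat \<Rightarrow> nat \<Rightarrow> 'a poly poly" where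
  "monomial_jet P a b 0 = 1"
| "monomial_jet P a b (Suc k) = curve_der P (monomial_jet P a b k)
     + (of_nat a * euler_Y P - of_nat b * euler_X P) * monomial_jet P a b k"

lemma coeff_coeff_of_nat_mult:
  "coeff (coeff (of_nat a * f) j) i = of_nat a * coeff (coeff f j) (i::nat)"
  by (induction a) (simp_all add: algebra_simps)

lemma euler_X_bmon: "euler_X (bmon a b) = of_nat a * bmon a b"
  by (intro poly_eqI) (simp add: coeff_coeff_euler_X coeff_coeff_of_nat_mult)

lemma euler_Y_bmon: "euler_Y (bmon a b) = of_nat b * bmon a b"
  by (intro poly_eqI) (auto simp add: coeff_coeff_euler_Y coeff_coeff_of_nat_mult)

lemma curve_der_power_bmon:
  "(curve_der P ^^ k) (bmon a b) = bmon a b * monomial_jet P a b k"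
proof (induction k)
  case (Suc k)
  have "curve_der P (bmon a b) = bmon a b * (of_nat a * euler_Y P - of_nat b * euler_X P)"
    by (simp add: curve_der_def euler_X_bmon euler_Y_bmon algebra_simps)
  then have "curve_der P (bmon a b * monomial_jet P a b k)
      = bmon a b * monomial_jet P a b (Suc k)"
    unfolding curve_der_mult by (simp add: distrib_left mult.assoc)
  then show ?case by (simp add: Suc)
qed simp

lemma bideg_le_of_nat_mult: "bideg_le M N f \<Longrightarrow> bideg_le M N (of_nat a * f)"
  by (rule bideg_leI, rule bideg_leD[of M N f]) (auto simp: coeff_coeff_of_nat_mult)

lemma bideg_le_monomial_jet:
  assumes "bideg_le m n P"
  shows "bideg_le (k * m) (k * n) (monomial_jet P a b k)"
proof (induction k)
  case 0
  show ?case using bideg_le_const[of 1] by (simp add: one_pCons)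
next
  case (Suc k)
  then show ?case
    by (auto intro!: bideg_le_add bideg_le_mult bideg_le_diff bideg_le_of_nat_mult
        bideg_le_euler_X bideg_le_euler_Y bideg_le_curve_der assms)
qed

lemma curve_der_smult: "curve_der P (smult [:c:] f) = smult [:c:] (curve_der P f)"
proof -
  have "curve_der P [:[:c:]:] = 0"
    by (simp add: curve_der_def euler_X_def euler_Y_def map_poly_pCons pderiv_pCons)
  then have "curve_der P ([:[:c:]:] * f) = [:[:c:]:] * curve_der P f"
    unfolding curve_der_mult by simp
  then show ?thesis by simp
qed

lemma curve_der_0: "curve_der P 0 = 0"
  using curve_der_smult[of P 0 0] by simp

lemma curve_der_sum: "curve_der P (sum f A) = (\<Sum>x\<in>A. curve_der P (f x))"
  by (induction A rule: infinite_finite_induct) (simp_all add: curve_der_add curve_der_0)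

lemma curve_der_power_combination:
  "(curve_der P ^^ k) (\<Sum>x\<in>A. smult [:c x:] (f x)) = (\<Sum>x\<in>A. smult [:c x:] ((curve_der P ^^ k) (f x)))"
  by (induction k) (simp_all add: curve_der_sum curve_der_smult)

text \<open>The exponent \<open>A - 1 - a\<close> of \<open>Y\<close> makes the polynomial \<open>Y ^ (A - 1)\<close> times an expression in \<open>X/Y\<close>,
  \<open>X ^ t\<close> and \<open>Y ^ t\<close>, so that the total degrees of all its monomials agree modulo \<open>t\<close>.\<close>

definition stepanov_poly ::
    "nat \<Rightarrow> nat \<Rightarrow> nat \<Rightarrow> (nat \<times> nat \<times> nat \<Rightarrow> 'a::field) \<Rightarrow> 'a poly poly" where
  "stepanov_poly t A B w = (\<Sum>(a, b, c)\<in>{..<A} \<times> {..<B} \<times> {..<B}.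
     smult [:w (a, b, c):] (bmon (a + b * t) (A - 1 - a + c * t)))"

text \<open>The conditions are indexed by a pair of values of \<open>(X^t, Y^t)\<close> and an order \<open>k\<close>, and each demands
  that a polynomial of bidegree \<open>(A - 1 + km, A - 1 + kn)\<close> be a multiple of \<open>P\<close>. The
  quotients are treated as further unknowns. This saves \<open>(A + km - m)(A + kn - n)\<close> from the number of
  monomials and leaves a linear cost of at most \<open>(m + n) A + 2kmn\<close>.\<close>

lemma auxiliary_polynomial_exists:
  fixes P :: "'a::field poly poly"
  assumes P: "bideg_le m n P" "P \<noteq> 0" and A: "m < A" "n < A"
    and C: "finite C" "card C \<le> h"
    and count: "h * (D * ((m + n) * A + m * n * D)) < A * B * B"
  shows "\<exists>w. (\<exists>s\<in>{..<A} \<times> {..<B} \<times> {..<B}. w s \<noteq> 0) \<and>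
    (\<forall>x y. (x ^ t, y ^ t) \<in> C \<longrightarrow> eval_at (x, y) P = 0 \<longrightarrow>
       derivation_at.vanishes (curve_der P) (eval_at (x, y)) D (stepanov_poly t A B w))"
proof -
  define T where "T = {..<A} \<times> {..<B} \<times> {..<B}"
  define W where "W = C \<times> {..<D}"
  define M where "M w = A - 1 + snd w * m" for w :: "('a \<times> 'a) \<times> nat"
  define N where "N w = A - 1 + snd w * n" for w :: "('a \<times> 'a) \<times> nat"
  define R where "R w = {..M w - m} \<times> {..N w - n}" for w
  have MN: "m \<le> M w" "n \<le> N w" for w using A by (simp_all add: M_def N_def)
  define U where "U = T <+> Sigma W R"
  \<comment> \<open>the \<open>k\<close>-th derivative of a monomial, with \<open>X^t\<close> and \<open>Y^t\<close> replaced by their values\<close>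
  define G where "G w s = (case s of (a, b, c) \<Rightarrow>
      smult [:fst (fst w) ^ b * snd (fst w) ^ c:]
        (bmon a (A - 1 - a) * monomial_jet P (a + b * t) (A - 1 - a + c * t) (snd w)))"
    for w :: "('a \<times> 'a) \<times> nat" and s :: "nat \<times> nat \<times> nat"
  define F where "F u w = (case u of Inl s \<Rightarrow> G w s
      | Inr (w', s) \<Rightarrow> if w' = w then P * bmon (fst s) (snd s) else 0)"
    for u :: "(nat \<times> nat \<times> nat) + (('a \<times> 'a) \<times> nat) \<times> (nat \<times> nat)" and w
  have finT: "finite T" and finW: "finite W" and finR: "finite (R w)" for w
    using C by (auto simp: T_def W_def R_def)
  have "\<exists>x. (\<exists>u\<in>U. x u \<noteq> 0) \<and> (\<forall>w\<in>W. (\<Sum>u\<in>U. smult [:x u:] (F u w)) = 0)"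
  proof (rule bivariate_relation[OF _ finW])
    show "finite U" using finT finW finR by (auto simp: U_def)
    show "bideg_le (M w) (N w) (F u w)" if "u \<in> U" "w \<in> W" for u w
    proof -
      from that consider (1) a b c where "a < A" "u = Inl (a, b, c)"
        | (2) w' i j where "(i, j) \<in> R w'" "u = Inr (w', i, j)"
        by (auto simp: U_def T_def Plus_def)
      then show ?thesis
      proof cases
        case 1
        have "bideg_le (A - 1) (A - 1) (bmon a (A - 1 - a) :: 'a poly poly)"
          using 1 by (intro bideg_le_bmon) auto
        from bideg_le_mult[OF this bideg_le_monomial_jet[OF P(1)]] show ?thesis
          unfolding F_def G_def M_def N_def 1 by (auto intro: bideg_le_smult)
      next
        case 2
        show ?thesis
        proof (cases "w' = w")
          case True
          have "bideg_le (M w - m) (N w - n) (bmon i j :: 'a poly poly)"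
            using 2 True by (intro bideg_le_bmon) (auto simp: R_def)
          from bideg_le_mult[OF P(1) this] show ?thesis
            using 2 True MN[of w] by (simp add: F_def)
        qed (simp add: F_def 2)
      qed
    qed
    have box: "Suc (M (g, k)) * Suc (N (g, k))
        \<le> card (R (g, k)) + ((m + n) * A + 2 * k * m * n)" for g k
    proof -
      define u where "u = M (g, k) - m"
      define v where "v = N (g, k) - n"
      have uv: "Suc (M (g, k)) = Suc u + m" "Suc (N (g, k)) = Suc v + n"
        using MN[of "(g, k)"] by (simp_all add: u_def v_def)
      have "Suc (M (g, k)) * Suc (N (g, k)) \<le> Suc u * Suc v + (n * Suc (M (g, k)) + m * Suc (N (g, k)))"
        unfolding uv by (simp add: algebra_simps)
      moreover have "n * Suc (M (g, k)) + m * Suc (N (g, k)) = (m + n) * A + 2 * k * m * n"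
        using A by (simp add: M_def N_def algebra_simps)
      moreover have "card (R (g, k)) = Suc u * Suc v"
        by (simp add: R_def u_def v_def)
      ultimately show ?thesis by simp
    qed
    have gauss: "(\<Sum>k<D. (m + n) * A + 2 * k * m * n) \<le> D * ((m + n) * A + m * n * D)"
    proof (induction D)
      case (Suc D)
      then show ?case by (simp add: algebra_simps)
    qed simp
    have "(\<Sum>w\<in>W. Suc (M w) * Suc (N w))
        \<le> (\<Sum>w\<in>W. card (R w) + ((m + n) * A + 2 * snd w * m * n))"
      by (rule sum_mono) (use box in auto)
    also have "\<dots> = (\<Sum>w\<in>W. card (R w)) + card C * (\<Sum>k<D. (m + n) * A + 2 * k * m * n)"
      unfolding W_def sum.distrib[of "\<lambda>w. card (R w)"]
      by (simp only: sum.cartesian_product' snd_conv sum_constant of_nat_id)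
    also have "\<dots> \<le> (\<Sum>w\<in>W. card (R w)) + h * (D * ((m + n) * A + m * n * D))"
      by (intro add_left_mono mult_le_mono C gauss)
    also have "\<dots> < (\<Sum>w\<in>W. card (R w)) + card T"
      using count by (simp add: T_def mult.assoc)
    also have "\<dots> = card U"
      using finT finW finR by (simp add: U_def card_Plus card_SigmaI)
    finally show "(\<Sum>w\<in>W. Suc (M w) * Suc (N w)) < card U" .
  qed
  then obtain x where x: "\<exists>u\<in>U. x u \<noteq> 0"
    "\<And>w. w \<in> W \<Longrightarrow> (\<Sum>u\<in>U. smult [:x u:] (F u w)) = 0" by blast
  define w where "w s = x (Inl s)" for s
  define Q where "Q v = (\<Sum>s\<in>R v. smult [:x (Inr (v, s)):] (bmon (fst s) (snd s)))" for v
  have rel: "(\<Sum>s\<in>T. smult [:w s:] (G v s)) + P * Q v = 0" if v: "v \<in> W" for v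
  proof -
    have "(\<Sum>u\<in>U. smult [:x u:] (F u v)) = (\<Sum>s\<in>T. smult [:w s:] (G v s))
        + (\<Sum>z\<in>Sigma W R. smult [:x (Inr z):] (F (Inr z) v))"
      unfolding U_def using finT finW finR by (simp add: sum.Plus F_def w_def)
    also have "(\<Sum>z\<in>Sigma W R. smult [:x (Inr z):] (F (Inr z) v))
        = (\<Sum>v'\<in>W. \<Sum>s\<in>R v'. smult [:x (Inr (v', s)):] (F (Inr (v', s)) v))"
      using finW finR by (simp add: sum.Sigma)
    also have "\<dots> = (\<Sum>v'\<in>W. if v' = v then P * Q v else 0)"
      by (rule sum.cong) (auto simp: F_def Q_def sum_distrib_left)
    also have "\<dots> = P * Q v" using finW v by simp
    finally show ?thesis using x(2)[OF v] by simp
  qed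
  have "\<exists>s\<in>T. w s \<noteq> 0"
  proof (rule ccontr)
    assume "\<not> (\<exists>s\<in>T. w s \<noteq> 0)"
    then have w0: "\<And>s. s \<in> T \<Longrightarrow> w s = 0" by blast
    have "Q v = 0" if "v \<in> W" for v using rel[OF that] w0 P(2) by simp
    then have "x (Inr (v, s)) = 0" if "v \<in> W" "s \<in> R v" for v s
      using coeff_bmon_combination[OF finR[of v], of "\<lambda>s. x (Inr (v, s))" "snd s" "fst s"] that
      by (simp add: Q_def)
    with w0 x(1) show False by (auto simp: U_def Plus_def w_def)
  qed
  moreover have "derivation_at.vanishes (curve_der P) (eval_at (a, b)) D (stepanov_poly t A B w)"
    if C: "(a ^ t, b ^ t) \<in> C" and P0: "eval_at (a, b) P = 0" for a b
  proof -
    interpret q: derivation_at "curve_der P" "eval_at (a, b)" by (rule derivation_at_curve)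
    have "eval_at (a, b) ((curve_der P ^^ k) (stepanov_poly t A B w)) = 0" if "k < D" for k
    proof -
      define v where "v = ((a ^ t, b ^ t), k)"
      have v: "v \<in> W" using C that by (simp add: v_def W_def)
      have "stepanov_poly t A B w
          = (\<Sum>s\<in>T. smult [:w s:] (case s of (i, j, l) \<Rightarrow> bmon (i + j * t) (A - 1 - i + l * t)))"
        unfolding stepanov_poly_def T_def by (rule sum.cong) auto
      then have "(curve_der P ^^ k) (stepanov_poly t A B w)
          = (\<Sum>s\<in>T. smult [:w s:] ((curve_der P ^^ k)
               (case s of (i, j, l) \<Rightarrow> bmon (i + j * t) (A - 1 - i + l * t))))"
        by (simp add: curve_der_power_combination)
      then have "eval_at (a, b) ((curve_der P ^^ k) (stepanov_poly t A B w))
          = (\<Sum>s\<in>T. w s * eval_at (a, b) ((curve_der P ^^ k)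
               (case s of (i, j, l) \<Rightarrow> bmon (i + j * t) (A - 1 - i + l * t))))"
        by (simp add: eval_at_sum eval_at_simps)
      also have "\<dots> = (\<Sum>s\<in>T. w s * eval_at (a, b) (G v s))"
      proof (rule sum.cong[OF refl])
        fix s assume "s \<in> T"
        obtain i j l where s: "s = (i, j, l)" by (cases s)
        have "a ^ (i + j * t) = a ^ i * (a ^ t) ^ j"
          by (metis mult.commute power_add power_mult)
        moreover have "b ^ (A - 1 - i + l * t) = b ^ (A - 1 - i) * (b ^ t) ^ l"
          by (metis mult.commute power_add power_mult)
        ultimately show "w s * eval_at (a, b) ((curve_der P ^^ k)
            (case s of (i, j, l) \<Rightarrow> bmon (i + j * t) (A - 1 - i + l * t)))
            = w s * eval_at (a, b) (G v s)"
          by (simp add: s G_def v_def curve_der_power_bmon eval_at_simps eval_at_bmon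
              mult.assoc mult.left_commute)
      qed
      also have "\<dots> = eval_at (a, b) ((\<Sum>s\<in>T. smult [:w s:] (G v s)) + P * Q v)"
        by (simp add: eval_at_sum eval_at_simps P0)
      finally show ?thesis using rel[OF v] by (simp add: eval_at_simps)
    qed
    then show ?thesis by (simp add: q.vanishes_def)
  qed
  ultimately show ?thesis unfolding T_def by blast
qed

lemma bideg_le_stepanov_poly:
  "0 < A \<Longrightarrow> 0 < B \<Longrightarrow>
    bideg_le (A - 1 + (B - 1) * t) (A - 1 + (B - 1) * t) (stepanov_poly t A B w)"
proof -
  assume "0 < A" "0 < B"
  have "bideg_le (A - 1 + (B - 1) * t) (A - 1 + (B - 1) * t)
      (smult [:w (a, b, c):] (bmon (a + b * t) (A - 1 - a + c * t)))"
    if "a < A" "b < B" "c < B" for a b c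
    using that by (intro bideg_le_smult bideg_le_bmon add_mono mult_le_mono) auto
  then show ?thesis unfolding stepanov_poly_def by (auto intro!: bideg_le_sum)
qed

section \<open>Lacunary polynomials\<close>

text \<open>Reversing the coefficients turns the monomial into a constant, so the reversal of a
  divisor is a constant too.\<close>

lemma two_monomials_not_dvd_monom:
  fixes q :: "'a::field poly"
  assumes "coeff q i1 \<noteq> 0" "coeff q i2 \<noteq> 0" "i1 \<noteq> i2" "c \<noteq> 0"
  shows "\<not> q dvd monom c e"
proof
  assume "q dvd monom c e"
  then obtain r where r: "monom c e = q * r" by blast
  have "reflect_poly (monom c e) = [:c:]"
    by (rule poly_eqI) (use assms in \<open>auto simp: coeff_reflect_poly degree_monom_eq coeff_pCons
      split: nat.split\<close>)
  then have "[:c:] = reflect_poly q * reflect_poly r" unfolding r reflect_poly_mult by simp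
  moreover from this have "reflect_poly q \<noteq> 0" "reflect_poly r \<noteq> 0" using assms(4) by auto
  ultimately have "degree (reflect_poly q) = 0"
    by (metis add_is_0 degree_mult_eq degree_pCons_0)
  moreover obtain i where i: "coeff q i \<noteq> 0" "i \<noteq> degree q" using assms by metis
  then have "i < degree q" by (simp add: le_degree le_neq_implies_less)
  then have "coeff (reflect_poly q) (degree q - i) \<noteq> 0" "degree q - i > 0"
    using i by (simp_all add: coeff_reflect_poly)
  ultimately show False using le_degree by force
qed

lemma finite_coeff_support: "finite {i. coeff F i \<noteq> 0}"
  by (rule finite_subset[of _ "{..degree F}"]) (auto intro: le_degree)

text \<open>For a monomial \<open>X^e\<close> of \<open>F\<close>, the polynomial \<open>X F' - e F\<close> has one monomial fewer than \<open>F\<close>: the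
  coefficients \<open>i - e\<close> of the others are nonzero because all exponents are below \<open>p\<close>. It is still divisible
  by \<open>q ^ (N - 1)\<close>. After finitely many steps a single monomial remains, and \<open>q\<close> does not divide it.\<close>

lemma power_dvd_lacunary:
  fixes F q :: "'a::field poly"
  assumes char: "\<And>k. 0 < k \<Longrightarrow> k < p \<Longrightarrow> (of_nat k :: 'a) \<noteq> 0"
    and q: "coeff q i1 \<noteq> 0" "coeff q i2 \<noteq> 0" "i1 \<noteq> i2"
    and "F \<noteq> 0" "\<And>i. coeff F i \<noteq> 0 \<Longrightarrow> i < p" "q ^ N dvd F"
  shows "N < card {i. coeff F i \<noteq> 0}"
  using assms(5-)
proof (induction N arbitrary: F)
  case 0
  then have "{i. coeff F i \<noteq> 0} \<noteq> {}" by (auto simp: poly_eq_iff)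
  then show ?case using finite_coeff_support[of F] by (simp add: card_gt_0_iff)
next
  case (Suc N)
  obtain e where e: "coeff F e \<noteq> 0" using Suc.prems(1) by (auto simp: poly_eq_iff)
  define H where "H = pCons 0 (pderiv F) - smult (of_nat e) F"
  have cH: "coeff H i = (of_nat i - of_nat e) * coeff F i" for i
    by (cases i) (simp_all add: H_def coeff_pderiv algebra_simps)
  have inj: "(of_nat i :: 'a) \<noteq> of_nat e" if "i \<noteq> e" "coeff F i \<noteq> 0" for i
  proof (cases "i < e")
    case True
    then have "(of_nat e :: 'a) - of_nat i = of_nat (e - i)" by (simp add: of_nat_diff)
    moreover have "e - i < p" using Suc.prems(2)[OF e] by simp
    ultimately show ?thesis using char[of "e - i"] True by auto
  next
    case False
    then have "(of_nat i :: 'a) - of_nat e = of_nat (i - e)" by (simp add: of_nat_diff)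
    moreover have "i - e < p" using Suc.prems(2)[OF that(2)] by simp
    ultimately show ?thesis using char[of "i - e"] False that(1) by auto
  qed
  have supp: "{i. coeff H i \<noteq> 0} = {i. coeff F i \<noteq> 0} - {e}"
    using inj by (auto simp: cH)
  show ?case
  proof (cases "H = 0")
    case True
    then have "{i. coeff F i \<noteq> 0} \<subseteq> {e}" using supp by auto
    then have "F = monom (coeff F e) e" by (auto simp: poly_eq_iff)
    moreover have "q dvd F" using Suc.prems(3) by (metis dvd_mult_left power_Suc)
    ultimately show ?thesis using two_monomials_not_dvd_monom[OF q e] by metis
  next
    case False
    obtain r where r: "F = q ^ Suc N * r" using Suc.prems(3) by blast
    have "pderiv F = q ^ N * (smult (of_nat (Suc N)) (pderiv q) * r + q * pderiv r)"
      unfolding r pderiv_mult pderiv_power_Suc by (simp add: algebra_simps)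
    then have "q ^ N dvd [:0, 1:] * pderiv F" by (metis dvd_mult dvd_triv_left)
    moreover have "q ^ N dvd F" using Suc.prems(3) by (metis dvd_mult_right power_Suc)
    ultimately have "q ^ N dvd H" unfolding H_def by (intro dvd_diff dvd_smult) simp_all
    moreover have "coeff H i \<noteq> 0 \<Longrightarrow> i < p" for i using supp Suc.prems(2) by blast
    ultimately have "N < card ({i. coeff F i \<noteq> 0} - {e})"
      using Suc.IH[OF False] supp by simp
    then show ?thesis using finite_coeff_support[of F] e by simp
  qed
qed

section \<open>Substitutions in two variables\<close>

lemma poly_map_poly_mult:
  fixes h :: "'b::comm_ring_1 \<Rightarrow> 'c::comm_ring_1"
  assumes "\<And>a b. h (a + b) = h a + h b" "\<And>a b. h (a * b) = h a * h b"
  shows "poly (map_poly h (f * g)) y = poly (map_poly h f) y * poly (map_poly h g) y"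
proof -
  have h0: "h 0 = 0" using assms(1)[of 0 0] by (metis add_cancel_right_left)
  have hsum: "h (sum k A) = (\<Sum>x\<in>A. h (k x))" for k :: "nat \<Rightarrow> 'b" and A
    by (induction A rule: infinite_finite_induct) (simp_all add: assms(1) h0)
  have "map_poly h (f * g) = map_poly h f * map_poly h g"
    by (rule poly_eqI) (simp add: coeff_map_poly h0 coeff_mult hsum assms(2))
  then show ?thesis by simp
qed

lemma poly_map_poly_add:
  fixes h :: "'b::comm_ring_1 \<Rightarrow> 'c::comm_ring_1"
  assumes "\<And>a b. h (a + b) = h a + h b"
  shows "poly (map_poly h (f + g)) y = poly (map_poly h f) y + poly (map_poly h g) y"
proof -
  have h0: "h 0 = 0" using assms(1)[of 0 0] by (metis add_cancel_right_left)
  have "map_poly h (f + g) = map_poly h f + map_poly h g"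
    by (rule poly_eqI) (simp add: coeff_map_poly h0 assms)
  then show ?thesis by simp
qed

definition bsubst :: "'a poly poly \<Rightarrow> 'a poly poly \<Rightarrow> 'a::field poly poly \<Rightarrow> 'a poly poly" where
  "bsubst x y f = poly (map_poly (\<lambda>c. poly (map_poly (\<lambda>a. [:[:a:]:]) c) x) f) y"

lemma bsubst_add: "bsubst x y (f + g) = bsubst x y f + bsubst x y g"
  unfolding bsubst_def by (intro poly_map_poly_add) simp

lemma bsubst_mult: "bsubst x y (f * g) = bsubst x y f * bsubst x y g"
  unfolding bsubst_def by (intro poly_map_poly_mult poly_map_poly_add) simp_all

lemma bsubst_0 [simp]: "bsubst x y 0 = 0"
  by (simp add: bsubst_def)

lemma bsubst_monomial: "bsubst x y (smult [:c:] (bmon i j)) = smult [:c:] (x ^ i * y ^ j)"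
  by (simp add: bsubst_def smult_monom map_poly_monom poly_monom)

lemma bsubst_1 [simp]: "bsubst x y 1 = 1"
proof -
  have "smult [:1:] (bmon 0 0) = (1 :: 'a poly poly)" by (simp add: monom_0 one_pCons)
  then show ?thesis using bsubst_monomial[of x y 1 0 0] by simp
qed

lemma bsubst_sum: "bsubst x y (sum f A) = (\<Sum>s\<in>A. bsubst x y (f s))"
  by (induction A rule: infinite_finite_induct) (simp_all add: bsubst_add)

lemma bsubst_prod: "bsubst x y (prod f A) = (\<Prod>s\<in>A. bsubst x y (f s))"
  by (induction A rule: infinite_finite_induct) (simp_all add: bsubst_mult)

lemma bmon_expansion:
  fixes f :: "'a::field poly poly"
  assumes "bideg_le M N f"
  shows "f = (\<Sum>s\<in>{..M} \<times> {..N}. smult [:coeff (coeff f (snd s)) (fst s):] (bmon (fst s) (snd s)))"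
    (is "f = ?g")
proof (intro poly_eqI)
  fix j i
  show "coeff (coeff f j) i = coeff (coeff ?g j) i"
    using bideg_leD[OF assms, of j i] coeff_bmon_combination[of "{..M} \<times> {..N}"
      "\<lambda>s. coeff (coeff f (snd s)) (fst s)" j i] by auto
qed

lemma bmon_power: "bmon i j ^ k = bmon (k * i) (k * j)"
  by (induction k) (simp_all add: mult_monom flip: monom_0 monom_eq_1)

definition rescale :: "'a \<Rightarrow> 'a \<Rightarrow> 'a::field poly poly \<Rightarrow> 'a poly poly" where
  "rescale a b = bsubst (smult [:a:] (bmon 1 0)) (smult [:b:] (bmon 0 1))"

lemma rescale_monomial:
  "rescale a b (smult [:c:] (bmon i j)) = smult [:c * (a ^ i * b ^ j):] (bmon i j)"
proof -
  have "smult [:a:] (bmon 1 0) ^ i * smult [:b:] (bmon 0 1) ^ j = smult [:a ^ i * b ^ j:] (bmon i j)"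
    unfolding smult_power bmon_power poly_const_pow
    by (simp add: mult_monom mult.commute)
  then show ?thesis unfolding rescale_def bsubst_monomial by (simp add: mult.commute)
qed

lemma coeff_rescale: "coeff (coeff (rescale a b f) j) i = a ^ i * b ^ j * coeff (coeff f j) i"
proof -
  obtain d where d: "bideg_le d d f" using bideg_le_ex by blast
  have "rescale a b f = (\<Sum>s\<in>{..d} \<times> {..d}.
      smult [:coeff (coeff f (snd s)) (fst s) * (a ^ fst s * b ^ snd s):] (bmon (fst s) (snd s)))"
    by (subst bmon_expansion[OF d]) (simp only: rescale_def bsubst_sum flip: rescale_monomial)
  then show ?thesis
    using bideg_leD[OF d, of j i] by (auto simp add: coeff_bmon_combination)
qed

lemma eval_at_rescale: "eval_at (u, v) (rescale a b f) = eval_at (a * u, b * v) f"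
proof -
  obtain d where d: "bideg_le d d f" using bideg_le_ex by blast
  have "eval_at (u, v) (rescale a b (smult [:c:] (bmon i j)))
      = eval_at (a * u, b * v) (smult [:c:] (bmon i j))" for c i j
    unfolding rescale_monomial
    by (simp add: eval_at_simps eval_at_bmon power_mult_distrib del: smult_pCons)
  then show ?thesis
    by (subst (1 2) bmon_expansion[OF d]) (simp only: rescale_def bsubst_sum eval_at_sum)
qed

abbreviation dilate :: "'a \<Rightarrow> 'a::field poly poly \<Rightarrow> 'a poly poly" where
  "dilate z \<equiv> rescale z z"

lemma dilate_monomial: "dilate z (smult [:c:] (bmon i j)) = smult [:c * z ^ (i + j):] (bmon i j)"
  by (simp only: rescale_monomial power_add)

lemma coeff_dilate: "coeff (coeff (dilate z f) j) i = z ^ (i + j) * coeff (coeff f j) i"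
  by (simp only: coeff_rescale power_add)

lemma dilate_mult: "dilate z (f * g) = dilate z f * dilate z g"
  by (simp add: rescale_def bsubst_mult)

lemma dilate_inverse: "z \<noteq> 0 \<Longrightarrow> dilate (1 / z) (dilate z f) = f"
  by (intro poly_eqI) (simp add: coeff_dilate power_one_over)

text \<open>Dilations are ring automorphisms.\<close>

lemma prime_elem_dilate:
  assumes "prime_elem P" "z \<noteq> 0"
  shows "prime_elem (dilate z P)"
proof (rule prime_elemI)
  have inv: "dilate z (dilate (1 / z) f) = f" for f
    using dilate_inverse[of "1 / z" f] assms by simp
  have dvd_iff: "dilate z P dvd f \<longleftrightarrow> P dvd dilate (1 / z) f" for f
    by (metis assms(2) dilate_inverse dilate_mult dvd_def inv)
  show "dilate z P \<noteq> 0"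
    using assms dilate_inverse[of z P] by (auto simp: rescale_def)
  have "dilate (1 / z) 1 = 1" by (simp add: rescale_def)
  then show "\<not> dilate z P dvd 1" using assms dvd_iff[of 1] by simp
  fix a b assume "dilate z P dvd a * b"
  then show "dilate z P dvd a \<or> dilate z P dvd b"
    using assms(1) by (simp add: dvd_iff dilate_mult prime_elem_dvd_mult_iff)
qed

text \<open>The substitution of \<open>ZY\<close> for \<open>X\<close>, with the new variable \<open>Z\<close> as inner variable. The coefficient of
  \<open>Y^k\<close> in the result is the homogeneous part of degree \<open>k\<close>, written in the ratio \<open>Z = X/Y\<close>.\<close>

definition blowup :: "'a::field poly poly \<Rightarrow> 'a poly poly" where
  "blowup = bsubst (bmon 1 1) (bmon 0 1)"

lemma blowup_monomial: "blowup (smult [:c:] (bmon i j)) = smult [:c:] (bmon i (i + j))"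
  unfolding blowup_def bsubst_monomial bmon_power by (simp add: mult_monom)

lemma coeff_blowup:
  "coeff (coeff (blowup f) k) i = (if i \<le> k then coeff (coeff f (k - i)) i else 0)"
proof -
  obtain d where d: "bideg_le d d f" using bideg_le_ex by blast
  have "blowup f = (\<Sum>s\<in>{..d} \<times> {..d}.
      smult [:coeff (coeff f (snd s)) (fst s):] (bmon (fst s) (fst s + snd s)))"
    by (subst bmon_expansion[OF d]) (simp only: blowup_def bsubst_sum flip: blowup_monomial)
  then have "coeff (coeff (blowup f) k) i = (\<Sum>s\<in>{..d} \<times> {..d}.
      if fst s + snd s = k \<and> fst s = i then coeff (coeff f (snd s)) (fst s) else 0)"
    by (simp add: coeff_sum) (rule sum.cong, auto)
  also have "\<dots> = (\<Sum>s\<in>{..d} \<times> {..d}.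
      if s = (i, k - i) then (if i \<le> k then coeff (coeff f (k - i)) i else 0) else 0)"
    by (rule sum.cong) auto
  also have "\<dots> = (if i \<le> k then coeff (coeff f (k - i)) i else 0)"
    using bideg_leD[OF d, of "k - i" i] by auto
  finally show ?thesis .
qed

text \<open>The lowest nonzero coefficient. As the leading coefficient of the reversed polynomial it is
  multiplicative.\<close>

definition trailing_coeff :: "'a::idom poly \<Rightarrow> 'a" where
  "trailing_coeff f = lead_coeff (reflect_poly f)"

lemma trailing_coeff_mult: "trailing_coeff (f * g) = trailing_coeff f * trailing_coeff g"
  by (simp add: trailing_coeff_def reflect_poly_mult lead_coeff_mult)

lemma trailing_coeff_prod: "trailing_coeff (prod f A) = (\<Prod>x\<in>A. trailing_coeff (f x))"
  by (induction A rule: infinite_finite_induct)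
     (simp_all add: trailing_coeff_mult, simp_all add: trailing_coeff_def)

lemma trailing_coeff_nonzero: "f \<noteq> 0 \<Longrightarrow> trailing_coeff f \<noteq> 0"
  by (simp add: trailing_coeff_def)

lemma trailing_coeff_is_coeff: "\<exists>k. trailing_coeff f = coeff f k"
  unfolding trailing_coeff_def using degree_reflect_poly_le[of f]
  by (auto simp: coeff_reflect_poly)

lemma trailing_coeff_eq:
  assumes "\<And>k. k < d \<Longrightarrow> coeff f k = 0" "coeff f d \<noteq> 0"
  shows "trailing_coeff f = coeff f d"
proof -
  have d: "d \<le> degree f" using assms(2) by (rule le_degree)
  have "degree (reflect_poly f) = degree f - d"
  proof (rule antisym)
    show "degree (reflect_poly f) \<le> degree f - d"
      by (rule degree_le) (use d assms(1) in \<open>auto simp: coeff_reflect_poly\<close>)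
    show "degree f - d \<le> degree (reflect_poly f)"
      by (rule le_degree) (use d assms(2) in \<open>simp add: coeff_reflect_poly\<close>)
  qed
  then show ?thesis using d by (simp add: trailing_coeff_def coeff_reflect_poly)
qed

lemma prod_prime_elems_dvd:
  fixes f :: "'b \<Rightarrow> 'c::idom"
  assumes "finite T" "\<And>z. z \<in> T \<Longrightarrow> prime_elem (f z)"
    and "\<And>z z'. z \<in> T \<Longrightarrow> z' \<in> T \<Longrightarrow> f z dvd f z' \<Longrightarrow> z = z'"
    and "\<And>z. z \<in> T \<Longrightarrow> f z dvd x"
  shows "prod f T dvd x"
  using assms
proof (induction T rule: finite_induct)
  case (insert z T)
  then obtain y where y: "x = prod f T * y" by (metis dvd_def insertCI)
  have "\<not> f z dvd prod f T"
  proof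
    assume dvd: "f z dvd prod f T"
    have pz: "prime_elem (f z)" by (rule insert.prems(1)) simp
    have "\<exists>z'\<in>T. f z dvd f z'"
      using insert.hyps(1) dvd
    proof (induction T rule: finite_induct)
      case empty
      then show ?case using pz by (auto simp: prime_elem_def)
    next
      case (insert u V)
      then show ?case using pz by (auto simp: prime_elem_dvd_mult_iff)
    qed
    then show False using insert.prems(2) insert.hyps(2) by (metis insertCI)
  qed
  then have "f z dvd y"
    using insert.prems(1)[of z] insert.prems(3)[of z] y by (simp add: prime_elem_dvd_mult_iff)
  then show ?case using insert.hyps y by (simp add: mult.commute mult_dvd_mono)
qed simp

section \<open>The auxiliary polynomial does not vanish on the curve\<close>

lemma stepanov_poly_coeff:
  assumes "A \<le> t" "a < A" "b < B" "c < B"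
  shows "coeff (coeff (stepanov_poly t A B w) (A - 1 - a + c * t)) (a + b * t) = w (a, b, c)"
proof -
  have eq: "(a', b', c') = (a, b, c)"
    if "a' < A" "b' < B" "c' < B" "a' + b' * t = a + b * t"
      "A - 1 - a' + c' * t = A - 1 - a + c * t" for a' b' c'
  proof -
    have "(x + y * t) mod t = x \<and> (x + y * t) div t = y" if "x < A" for x y
      using that assms(1) by simp
    from this[OF that(1), of b'] this[OF assms(2), of b] have "a' = a" "b' = b"
      using that(4) by simp_all
    moreover have "0 < t" using assms by linarith
    ultimately show ?thesis using that(5) by simp
  qed
  have "coeff (coeff (stepanov_poly t A B w) (A - 1 - a + c * t)) (a + b * t)
      = (\<Sum>s\<in>{..<A} \<times> {..<B} \<times> {..<B}. if s = (a, b, c) then w s else 0)"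
    unfolding stepanov_poly_def coeff_sum
    by (rule sum.cong) (use eq in \<open>auto split: prod.splits\<close>)
  then show ?thesis using assms by simp
qed

lemma dilate_stepanov_poly:
  assumes "z ^ t = 1"
  shows "dilate z (stepanov_poly t A B w) = smult [:z ^ (A - 1):] (stepanov_poly t A B w)"
proof -
  have "z ^ (a + b * t + (A - 1 - a + c * t)) = z ^ (A - 1)" if "a < A" for a b c
  proof -
    have "a + b * t + (A - 1 - a + c * t) = A - 1 + t * (b + c)"
      using that by (simp add: algebra_simps)
    then show ?thesis using assms by (simp add: power_add power_mult)
  qed
  then have "dilate z (smult [:w (a, b, c):] (bmon (a + b * t) (A - 1 - a + c * t)))
      = smult [:z ^ (A - 1):] (smult [:w (a, b, c):] (bmon (a + b * t) (A - 1 - a + c * t)))"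
    if "a < A" for a b c
    using that unfolding dilate_monomial by (simp add: mult.commute)
  moreover have "smult k (sum f S) = (\<Sum>s\<in>S. smult k (f s))"
    for k and f :: "nat \<times> nat \<times> nat \<Rightarrow> 'a poly poly" and S
    by (induction S rule: infinite_finite_induct) (simp_all add: smult_add_right)
  moreover have "dilate z (sum f S) = (\<Sum>s\<in>S. dilate z (f s))"
    for f :: "nat \<times> nat \<times> nat \<Rightarrow> 'a poly poly" and S
    by (simp add: rescale_def bsubst_sum)
  ultimately show ?thesis unfolding stepanov_poly_def by (auto intro!: sum.cong)
qed

text \<open>Comparing bidegrees, the quotient is a constant \<open>c\<close>. So \<open>z\<^sub>2 / z\<^sub>1\<close> has the same power \<open>c\<close> for all
  total degrees that occur in \<open>P\<close>.\<close>

lemma dilate_associated: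
  fixes P :: "'a::field poly poly"
  assumes P: "bideg_le m n P" "coeff (coeff P j0) m \<noteq> 0" "degree P = n"
    and z: "z1 \<noteq> 0" "z2 \<noteq> 0" and dvd: "dilate z1 P dvd dilate z2 P"
  shows "\<exists>c. \<forall>i j. coeff (coeff P j) i \<noteq> 0 \<longrightarrow> (z2 / z1) ^ (i + j) = c"
proof -
  obtain r where r: "dilate z2 P = dilate z1 P * r" using dvd by blast
  have "bideg_le 0 0 r"
  proof (rule bideg_le_cofactor)
    show b: "bideg_le m n (dilate z1 P)"
      by (rule bideg_leI, rule bideg_leD[OF P(1)]) (auto simp: coeff_dilate)
    show "coeff (coeff (dilate z1 P) j0) m \<noteq> 0" using P(2) z by (simp add: coeff_dilate)
    have "P \<noteq> 0" using P(2) by auto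
    then obtain i where "coeff (coeff P n) i \<noteq> 0"
      using P(3) by (metis leading_coeff_0_iff)
    then have "coeff (dilate z1 P) n \<noteq> 0"
      using z by (metis coeff_0 coeff_dilate mult_eq_0_iff power_not_zero)
    then show "degree (dilate z1 P) = n"
      using b by (simp add: bideg_le_def antisym le_degree)
    show "bideg_le (m + 0) (n + 0) (dilate z1 P * r)"
      unfolding r[symmetric]
      by (rule bideg_leI, rule bideg_leD[of "m + 0" "n + 0" P]) (use P(1) in \<open>auto simp: coeff_dilate\<close>)
  qed
  then have deg0: "degree r = 0" "degree (coeff r 0) = 0" by (auto simp: bideg_le_def)
  from deg0(1) obtain s where s: "r = [:s:]" by (rule degree_eq_zeroE)
  with deg0(2) have "degree s = 0" by simp
  then obtain c where "s = [:c:]" by (rule degree_eq_zeroE)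
  with s have c: "r = [:[:c:]:]" by simp
  have "(z2 / z1) ^ (i + j) = c" if "coeff (coeff P j) i \<noteq> 0" for i j
  proof -
    have "dilate z2 P = smult [:c:] (dilate z1 P)" using r c by (simp add: mult.commute)
    then have "coeff (coeff (dilate z2 P) j) i = coeff (coeff (smult [:c:] (dilate z1 P)) j) i"
      by simp
    then have "z2 ^ (i + j) * coeff (coeff P j) i = c * (z1 ^ (i + j) * coeff (coeff P j) i)"
      by (simp add: coeff_dilate)
    then show ?thesis using that z by (simp add: power_divide field_simps)
  qed
  then show ?thesis by blast
qed

lemma card_le_roots_mult_image:
  fixes G :: "'a::field set"
  assumes "finite G" "0 < g"
  shows "card G \<le> g * card ((\<lambda>z. z ^ g) ` G)"
proof -
  have "card {z \<in> G. z ^ g = y} \<le> g" for y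
  proof -
    define f where "f = monom 1 g - [:y:]"
    have "coeff f g = 1" using assms(2) by (simp add: f_def coeff_pCons split: nat.split)
    then have "f \<noteq> 0" by auto
    have "degree f \<le> g" unfolding f_def by (intro degree_diff_le degree_monom_le) simp
    have "{z \<in> G. z ^ g = y} \<subseteq> {z. poly f z = 0}" by (auto simp: f_def poly_monom)
    then have "card {z \<in> G. z ^ g = y} \<le> card {z. poly f z = 0}"
      using poly_roots_finite[OF \<open>f \<noteq> 0\<close>] card_mono by blast
    also have "\<dots> \<le> degree f" by (rule card_poly_roots_bound) (rule \<open>f \<noteq> 0\<close>)
    finally show ?thesis using \<open>degree f \<le> g\<close> by simp
  qed
  then have "(\<Sum>y\<in>(\<lambda>z. z ^ g) ` G. card {z \<in> G. z ^ g = y}) \<le> (\<Sum>y\<in>(\<lambda>z. z ^ g) ` G. g)"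
    by (intro sum_mono)
  moreover have "card G = (\<Sum>y\<in>(\<lambda>z. z ^ g) ` G. card {z \<in> G. z ^ g = y})"
    using sum.image_gen[OF assms(1), of "\<lambda>_. 1::nat" "\<lambda>z. z ^ g"] by simp
  ultimately show ?thesis by (simp add: mult.commute)
qed

text \<open>The numbers \<open>z \<in> G\<close> fall into at least \<open>t/g\<close> classes according to \<open>z ^ g\<close>, and polynomials
  \<open>P(zX, zY)\<close> from different classes are not associated. Hence their product divides the auxiliary polynomial
  if one of them does. Then the lowest form of that polynomial is divisible by a power with exponent at
  least \<open>t/g\<close>, but it has at most \<open>AB \<le> t/g\<close> monomials.\<close>

lemma not_dvd_stepanov_poly:
  fixes P :: "'a::field poly poly" and G :: "'a set"
  assumes char: "\<And>k. 0 < k \<Longrightarrow> k < p \<Longrightarrow> (of_nat k :: 'a) \<noteq> 0"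
    and prime: "prime_elem P"
    and P: "bideg_le m n P" "coeff (coeff P j0) m \<noteq> 0" "degree P = n"
    and low: "\<And>i j. coeff (coeff P j) i \<noteq> 0 \<Longrightarrow> d \<le> i + j"
    and low2: "coeff (coeff P j1) i1 \<noteq> 0" "coeff (coeff P j2) i2 \<noteq> 0"
      "i1 + j1 = d" "i2 + j2 = d" "i1 \<noteq> i2"
    and g: "0 < g" "\<And>w::'a. w \<noteq> 0 \<Longrightarrow> \<exists>c. \<forall>i j. coeff (coeff P j) i \<noteq> 0 \<longrightarrow> w ^ (i + j) = c \<Longrightarrow> w ^ g = 1"
    and G: "finite G" "card G = t" "0 \<notin> G" "\<And>z. z \<in> G \<Longrightarrow> z ^ t = 1"
    and AB: "A \<le> t" "g * (A * B) \<le> t" "B * t \<le> p"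
    and w: "\<exists>s\<in>{..<A} \<times> {..<B} \<times> {..<B}. w s \<noteq> 0"
  shows "\<not> P dvd stepanov_poly t A B w"
proof
  define \<Psi> where "\<Psi> = stepanov_poly t A B w"
  assume "P dvd stepanov_poly t A B w"
  then obtain Q where Q: "\<Psi> = P * Q" unfolding \<Psi>_def by blast
  have dil: "dilate z P dvd \<Psi>" if "z \<in> G" for z
  proof -
    have "smult [:z ^ (A - 1):] \<Psi> = dilate z P * dilate z Q"
      using dilate_stepanov_poly[OF G(4)[OF that]] Q by (metis \<Psi>_def dilate_mult)
    moreover have "\<Psi> = smult [:1 / z ^ (A - 1):] (smult [:z ^ (A - 1):] \<Psi>)"
      using that G(3) by (intro poly_eqI) auto
    ultimately show ?thesis by (metis dvd_smult dvd_triv_left)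
  qed
  \<comment> \<open>one representative for each value of \<open>z ^ g\<close>\<close>
  obtain T where T: "T \<subseteq> G" "inj_on (\<lambda>z. z ^ g) T" "(\<lambda>z. z ^ g) ` T = (\<lambda>z. z ^ g) ` G"
    using subset_image_inj[of "(\<lambda>z. z ^ g) ` G" "\<lambda>z. z ^ g" G] by auto
  have finT: "finite T" using T(1) G(1) finite_subset by blast
  have "t \<le> g * card T"
    using card_le_roots_mult_image[OF G(1) g(1)] T(2,3) G(2) by (metis card_image)
  then have "g * (A * B) \<le> g * card T" using AB(2) by linarith
  then have cardT: "A * B \<le> card T" using g(1) by simp
  have "(\<Prod>z\<in>T. dilate z P) dvd \<Psi>"
  proof (rule prod_prime_elems_dvd[OF finT])
    show "prime_elem (dilate z P)" if "z \<in> T" for z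
      using that T(1) G(3) by (intro prime_elem_dilate prime) auto
    show "dilate z P dvd \<Psi>" if "z \<in> T" for z using dil that T(1) by blast
    fix z z' assume z: "z \<in> T" "z' \<in> T" "dilate z P dvd dilate z' P"
    then have nz: "z \<noteq> 0" "z' \<noteq> 0" using T(1) G(3) by auto
    have "(z' / z) ^ g = 1"
      by (rule g(2)) (use nz dilate_associated[OF P nz z(3)] in auto)
    then have "z ^ g = z' ^ g" using nz by (simp add: power_divide)
    then show "z = z'" using T(2) z by (auto dest: inj_onD)
  qed
  then obtain R where R: "\<Psi> = (\<Prod>z\<in>T. dilate z P) * R" by blast
  \<comment> \<open>the lowest form of \<open>P\<close> in the variable \<open>Z\<close>\<close>
  define q where "q = coeff (blowup P) d"
  have q: "coeff q i1 \<noteq> 0" "coeff q i2 \<noteq> 0"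
  proof -
    have "d - i1 = j1" "d - i2 = j2" "i1 \<le> d" "i2 \<le> d" using low2(3,4) by auto
    then show "coeff q i1 \<noteq> 0" "coeff q i2 \<noteq> 0"
      using low2(1,2) by (simp_all add: q_def coeff_blowup)
  qed
  have trail: "trailing_coeff (blowup (dilate z P)) = smult (z ^ d) q" if "z \<noteq> 0" for z
  proof -
    have "coeff (blowup (dilate z P)) d = smult (z ^ d) q"
      by (rule poly_eqI) (simp add: q_def coeff_blowup coeff_dilate)
    moreover have "smult (z ^ d) q \<noteq> 0" using q that by auto
    moreover have "coeff (blowup (dilate z P)) k = 0" if "k < d" for k
    proof (rule poly_eqI)
      show "coeff (coeff (blowup (dilate z P)) k) i = coeff 0 i" for i
        using low[of "k - i" i] that by (auto simp: coeff_blowup coeff_dilate)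
    qed
    ultimately show ?thesis by (metis trailing_coeff_eq)
  qed
  define F where "F = trailing_coeff (blowup \<Psi>)"
  have "F = (\<Prod>z\<in>T. smult (z ^ d) q) * trailing_coeff (blowup R)"
  proof -
    have "F = (\<Prod>z\<in>T. trailing_coeff (blowup (dilate z P))) * trailing_coeff (blowup R)"
      unfolding F_def R blowup_def bsubst_mult bsubst_prod trailing_coeff_mult trailing_coeff_prod ..
    moreover have "trailing_coeff (blowup (dilate z P)) = smult (z ^ d) q" if "z \<in> T" for z
      using that T(1) G(3) by (intro trail) auto
    ultimately show ?thesis by simp
  qed
  moreover have "(\<Prod>z\<in>T. smult (z ^ d) q) = smult (\<Prod>z\<in>T. z ^ d) (q ^ card T)"
    by (simp add: prod_smult)
  ultimately have "q ^ card T dvd F" by (simp add: dvd_smult)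
  then have dvdF: "q ^ (A * B) dvd F" using cardT by (meson dvd_trans le_imp_power_dvd)
  obtain a b c where abc: "a < A" "b < B" "c < B" "w (a, b, c) \<noteq> 0" using w by auto
  have "coeff (coeff (blowup \<Psi>) (a + b * t + (A - 1 - a + c * t))) (a + b * t) = w (a, b, c)"
    unfolding coeff_blowup \<Psi>_def using stepanov_poly_coeff[OF AB(1) abc(1-3)] by simp
  then have "blowup \<Psi> \<noteq> 0" using abc(4) by auto
  then have "F \<noteq> 0" unfolding F_def by (rule trailing_coeff_nonzero)
  obtain k where k: "F = coeff (blowup \<Psi>) k"
    unfolding F_def using trailing_coeff_is_coeff by blast
  define E where "E = (\<lambda>(a, b). a + b * t) ` ({..<A} \<times> {..<B})"
  have supp: "{i. coeff F i \<noteq> 0} \<subseteq> E"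
  proof
    fix i assume "i \<in> {i. coeff F i \<noteq> 0}"
    then have "coeff (coeff \<Psi> (k - i)) i \<noteq> 0"
      by (auto simp: k coeff_blowup split: if_splits)
    then obtain s where "s \<in> {..<A} \<times> {..<B} \<times> {..<B}" and
      "coeff (coeff (case s of (a, b, c) \<Rightarrow>
         smult [:w (a, b, c):] (bmon (a + b * t) (A - 1 - a + c * t))) (k - i)) i \<noteq> 0"
      unfolding \<Psi>_def stepanov_poly_def coeff_sum by (meson sum.not_neutral_contains_not_neutral)
    then show "i \<in> E" by (fastforce simp: E_def split: if_splits)
  qed
  have "card {i. coeff F i \<noteq> 0} \<le> card E" by (rule card_mono) (use supp in \<open>auto simp: E_def\<close>)
  also have "card E \<le> card ({..<A} \<times> {..<B})" unfolding E_def by (rule card_image_le) simp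
  finally have "card {i. coeff F i \<noteq> 0} \<le> A * B" by simp
  moreover have "A * B < card {i. coeff F i \<noteq> 0}"
  proof (rule power_dvd_lacunary[OF char q low2(5) \<open>F \<noteq> 0\<close> _ dvdF])
    fix i assume "coeff F i \<noteq> 0"
    then have "i \<in> E" using supp by auto
    then obtain a b where "i = a + b * t" "a < A" "b < B" by (auto simp: E_def)
    then have "i < Suc b * t" "Suc b * t \<le> B * t" using AB(1) by (simp_all del: mult_Suc add: mult_le_mono1, simp)
    then show "i < p" using AB(3) by linarith
  qed
  ultimately show False by simp
qed

section \<open>Choice of the parameters\<close>

text \<open>The parameters below are rounded to integers, and \<open>D\<close> must be positive. Both are harmless once
  \<open>(t\<^sup>2/h)^(1/3)\<close> is large compared with \<open>mng\<close>, which is at most \<open>(m + n)\<^sup>3 / 4\<close>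
  because \<open>g \<le> m + n\<close>. As \<open>h\<^sup>2 \<le> t\<close>, this number is at least
  the square root of \<open>t\<close>.\<close>

definition threshold :: "nat \<Rightarrow> nat \<Rightarrow> real" where
  "threshold m n = (24 * real (m + n) ^ 3) ^ 2"

text \<open>With \<open>x = (ht)^(1/3)\<close> and \<open>y = t/x\<close> the choice is \<open>B \<approx> x\<close>, \<open>A \<approx> y/g\<close> and \<open>D \<approx> y/(6mng)\<close>. Since
  \<open>hy = x\<^sup>2\<close>, the number of equations is about \<open>(m + n + 1/6)/(6mng) A x\<^sup>2\<close>, less than the \<open>A B\<^sup>2\<close> unknowns,
  and \<open>Bt/D \<approx> 6mng x\<^sup>2\<close>. The bound on \<open>t\<close> in terms of \<open>p\<close> says \<open>(xt)\<^sup>3 = h t^4 \<le> p\<^sup>3/16\<close>, which keeps all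
  exponents below \<open>p\<close>. The constants \<open>8\<close> in place of \<open>6\<close> and \<open>3/4\<close> below absorb the rounding.\<close>

lemma stepanov_parameters:
  fixes m n g h t p :: nat
  assumes mn: "1 \<le> m" "1 \<le> n" and g: "1 \<le> g" "g \<le> m + n" and h: "1 \<le> h"
    and t: "real h ^ 2 \<le> real t" "threshold m n \<le> real t"
    and p: "real t \<le> 1 / 2 * real p powr (3 / 4) * real h powr (- 1 / 4)"
  obtains A B D where "m < A" "n < A" "0 < B" "0 < D" "D \<le> p" "t < p"
    "h * (D * ((m + n) * A + m * n * D)) < A * B * B"
    "A \<le> t" "g * (A * B) \<le> t" "B * t \<le> p"
    "real (B * t) \<le> 8 * real (m * n * g) * (real h powr (2 / 3) * real t powr (2 / 3)) * real D"
proof -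
  define K where "K = 24 * real (m + n) ^ 3"
  have mn2: "2 \<le> real (m + n)" using mn by linarith
  have mn_pow: "4 \<le> real (m + n) ^ 2" "8 \<le> real (m + n) ^ 3"
    using power_mono[OF mn2, of 2] power_mono[OF mn2, of 3] by simp_all
  have K192: "192 \<le> K" using mn_pow(2) by (simp add: K_def)
  have tK: "K ^ 2 \<le> real t" using t(2) by (simp add: threshold_def K_def)
  have "192 ^ 2 \<le> K ^ 2" by (rule power_mono) (use K192 in auto)
  then have t64: "64 \<le> real t" using tK by simp
  have h0: "0 < real h" using h by simp
  define x where "x = (real h * real t) powr (1 / 3)"
  have ht: "64 \<le> real h * real t" using h t64 mult_mono[of 1 "real h" 64 "real t"] by simp
  have "0 < t" using t64 by (cases t) auto
  then have x0: "0 < x" using h by (simp add: x_def)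
  have x3: "x ^ 3 = real h * real t"
    using ht x0 by (simp add: x_def powr_powr flip: powr_numeral)
  have x2: "x ^ 2 = real h powr (2 / 3) * real t powr (2 / 3)"
    using ht x0 by (simp add: x_def powr_powr powr_mult flip: powr_numeral)
  have x4: "4 \<le> x"
  proof (rule ccontr)
    assume "\<not> 4 \<le> x"
    then have "x ^ 3 < 4 ^ 3" using x0 by (intro power_strict_mono) auto
    then show False using x3 ht by simp
  qed
  define y where "y = real t / x"
  have y0: "0 < y" using x0 t64 by (simp add: y_def)
  have xy: "x * y = real t" using x0 by (simp add: y_def)
  have hy: "real h * y = x ^ 2" using x0 x3 by (simp add: y_def field_simps power2_eq_square power3_eq_cube)
  \<comment> \<open>from \<open>y\<^sup>3 = t\<^sup>2/h\<close> and \<open>h\<^sup>2 \<le> t\<close>\<close>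
  have yK: "K \<le> y"
  proof (rule ccontr)
    assume "\<not> K \<le> y"
    then have "y ^ 6 < K ^ 6" using y0 by (intro power_strict_mono) auto
    moreover have "y ^ 6 * real h ^ 2 = real t ^ 4"
    proof -
      have "y ^ 6 * real h ^ 2 = (y ^ 2 * (real h * y)) ^ 2" by (simp add: power_mult_distrib field_simps flip: power_mult power_add)
      also have "\<dots> = (x * y) ^ 4" unfolding hy by (simp add: power_mult_distrib flip: power_mult)
      finally show ?thesis by (simp add: xy)
    qed
    moreover have "y ^ 6 * real h ^ 2 \<le> y ^ 6 * real t" using t(1) y0 by (intro mult_left_mono) auto
    ultimately have "real t ^ 4 < K ^ 6 * real t" using t64 by (smt (verit) mult_strict_right_mono)
    then have "real t ^ 3 < (K ^ 2) ^ 3"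
      using t64 by (simp add: eval_nat_numeral mult.assoc)
    then show False using tK power_mono[OF tK, of 3] by simp
  qed
  have p_bound: "16 * (real h * real t ^ 4) \<le> real p ^ 3"
  proof -
    have p0: "0 < real p"
    proof (rule ccontr)
      assume "\<not> 0 < real p"
      then have "real p = 0" by simp
      then show False using p t64 by simp
    qed
    have "real t ^ 4 \<le> (1 / 2 * real p powr (3 / 4) * real h powr (- 1 / 4)) ^ 4"
      by (rule power_mono) (use p in auto)
    also have "\<dots> = 1 / 16 * (real p powr (3 / 4)) ^ 4 * (real h powr (- 1 / 4)) ^ 4"
      by (simp add: power_mult_distrib power_divide)
    also have "(real p powr (3 / 4)) ^ 4 = real p ^ 3"
      using p0 by (simp add: powr_powr flip: powr_numeral)
    also have "(real h powr (- 1 / 4)) ^ 4 = 1 / real h"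
    proof -
      have "(real h powr (- 1 / 4)) ^ 4 = (real h powr (- 1 / 4)) powr 4"
        using h0 by simp
      also have "\<dots> = real h powr (- 1)" unfolding powr_powr by simp
      finally show ?thesis using h0 by (simp add: powr_minus_divide)
    qed
    finally show ?thesis using h0 by (simp add: field_simps)
  qed
  have xtp: "x * real t \<le> real p"
  proof (rule ccontr)
    assume "\<not> x * real t \<le> real p"
    then have "real p ^ 3 < (x * real t) ^ 3" by (intro power_strict_mono) auto
    also have "\<dots> = real h * real t ^ 4" unfolding power_mult_distrib x3
      by (simp add: eval_nat_numeral)
    finally show False using p_bound h0 t64 by (smt (verit) mult_pos_pos zero_less_power)
  qed
  define B where "B = nat \<lfloor>x\<rfloor>"
  have B: "real B \<le> x" "x - 1 < real B" "0 < B" using x4 unfolding B_def by linarith+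
  define A where "A = t div (g * B)"
  have gB: "0 < g * B" using g B by simp
  have A1: "A * (g * B) \<le> t" by (simp add: A_def)
  have "t < (A + 1) * (g * B)"
  proof -
    have "t mod (g * B) < g * B" using gB by (rule mod_less_divisor)
    moreover have "A * (g * B) + t mod (g * B) = t" unfolding A_def by (rule div_mult_mod_eq)
    ultimately show ?thesis unfolding add_mult_distrib by linarith
  qed
  then have "real t < (real A + 1) * (real g * real B)"
    by (metis of_nat_1 of_nat_add of_nat_less_iff of_nat_mult)
  also have "\<dots> \<le> (real A + 1) * (real g * x)" using B by (intro mult_left_mono) auto
  finally have "x * y < x * ((real A + 1) * real g)" by (simp add: xy ac_simps)
  then have yA: "y < (real A + 1) * real g" using x0 by simp
  have A5: "5 + real (m + n) \<le> real A"
  proof -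
    have "K \<le> (real A + 1) * real (m + n)"
    proof -
      have "(real A + 1) * real g \<le> (real A + 1) * real (m + n)"
        using g by (intro mult_left_mono) auto
      then show ?thesis using yK yA by linarith
    qed
    then have "24 * real (m + n) ^ 2 \<le> real A + 1"
      using mn2 by (simp add: K_def eval_nat_numeral)
    moreover have "2 * real (m + n) \<le> real (m + n) ^ 2"
      unfolding power2_eq_square by (rule mult_right_mono[OF mn2]) simp
    ultimately show ?thesis using mn2 by simp
  qed
  define M where "M = real (m * n * g)"
  have M0: "0 < M" using mn g by (simp add: M_def)
  have "4 * M \<le> real (m + n) ^ 3"
  proof -
    have "4 * real (m * n) \<le> real (m + n) ^ 2"
      using zero_le_power2[of "real m - real n"] by (simp add: power2_eq_square algebra_simps)
    then have "4 * real (m * n) * real g \<le> real (m + n) ^ 2 * real (m + n)"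
      using g by (intro mult_mono) auto
    then show ?thesis by (simp add: M_def eval_nat_numeral)
  qed
  then have yM: "24 * M \<le> y" using yK M0 by (simp add: K_def)
  define D where "D = nat \<lfloor>y / (6 * M)\<rfloor>"
  have "4 \<le> y / (6 * M)" using yM M0 by (simp add: field_simps)
  then have D: "real D \<le> y / (6 * M)" "y / (6 * M) - 1 < real D" "0 < D"
    unfolding D_def by linarith+
  have D6: "6 * M * real D \<le> y" using D(1) M0 by (simp add: field_simps)
  have D8: "y \<le> 8 * M * real D"
  proof -
    have "y \<le> 6 * M * real D + 6 * M" using D(2) M0 by (simp add: field_simps)
    then show ?thesis using yM by linarith
  qed
  have At: "A \<le> t" by (simp add: A_def)
  have "t < p"
  proof -
    have "1 * real t < x * real t" using x4 t64 by (intro mult_strict_right_mono) auto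
    then show ?thesis using xtp by simp
  qed
  moreover have "D \<le> p"
  proof -
    have "real D \<le> y"
    proof -
      have "1 \<le> M" unfolding M_def using mn g by (metis One_nat_def Suc_leI mult_pos_pos
        less_eq_Suc_le of_nat_1 of_nat_le_iff)
      then have "real D \<le> 6 * M * real D" by (simp add: mult_le_cancel_right1)
      then show ?thesis using D6 by simp
    qed
    also have "\<dots> \<le> x * y" using x4 y0 by simp
    finally have "D \<le> t" by (simp add: xy)
    then show ?thesis using \<open>t < p\<close> by simp
  qed
  moreover have "B * t \<le> p"
  proof -
    have "real B * real t \<le> x * real t" using B by (intro mult_right_mono) auto
    then have "real (B * t) \<le> real p" using xtp by simp
    then show ?thesis by (simp only: of_nat_le_iff)
  qed
  moreover have "real (B * t) \<le> 8 * real (m * n * g) * (real h powr (2 / 3) * real t powr (2 / 3)) * real D"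
  proof -
    have "real (B * t) \<le> x * real t" using B mult_right_mono[of "real B" x "real t"] by simp
    also have "\<dots> = x ^ 2 * y" by (simp add: power2_eq_square flip: xy)
    also have "\<dots> \<le> x ^ 2 * (8 * M * real D)" using D8 by (intro mult_left_mono) auto
    finally show ?thesis by (simp add: M_def x2 ac_simps)
  qed
  moreover have "h * (D * ((m + n) * A + m * n * D)) < A * B * B"
  proof -
    define k where "k = real (m * n)"
    have k1: "1 \<le> k" unfolding k_def using mn by (metis One_nat_def Suc_leI mult_pos_pos
        less_eq_Suc_le of_nat_1 of_nat_le_iff)
    have Mk: "M = k * real g" by (simp add: M_def k_def)
    have g0: "0 < real g" using g by simp
    have "6 * k * real D * real g < (real A + 1) * real g"
      using D6 yA by (simp add: Mk ac_simps)
    then have "6 * k * real D < real A + 1" using g0 by simp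
    then have kD: "k * real D \<le> real A / 5" using A5 mn2 by simp
    have "real (m + n) \<le> 2 * k"
    proof -
      have "0 \<le> (real m - 1) * (real n - 1)" using mn by (intro mult_nonneg_nonneg) auto
      then show ?thesis using k1 by (simp add: k_def algebra_simps)
    qed
    then have "real (m + n) * real A + k * real D \<le> (2 * k + 1 / 5) * real A"
      using kD mult_right_mono[of "real (m + n)" "2 * k" "real A"] by (simp add: algebra_simps)
    also have "\<dots> \<le> (11 / 5 * k) * real A" using k1 by (intro mult_right_mono) auto
    finally have b1: "real (m + n) * real A + k * real D \<le> 11 / 5 * k * real A" .
    have "k * real D \<le> M * real D" unfolding Mk using g k1 by (intro mult_right_mono) auto
    then have "real h * (6 * (k * real D)) \<le> real h * y" using D6 by (intro mult_left_mono) auto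
    then have b2: "real h * (k * real D) \<le> x ^ 2 / 6" by (simp add: hy)
    have "real h * (real D * (real (m + n) * real A + k * real D))
        \<le> real h * (real D * (11 / 5 * k * real A))"
      using b1 by (intro mult_left_mono) auto
    also have "\<dots> = 11 / 5 * (real h * (k * real D)) * real A" by (simp add: ac_simps)
    also have "\<dots> \<le> 11 / 5 * (x ^ 2 / 6) * real A" using b2 by (intro mult_right_mono mult_left_mono) auto
    also have "\<dots> < real A * (3 / 4 * x) ^ 2"
      using x0 A5 mn2 by (simp add: power_mult_distrib power_divide)
    also have "\<dots> \<le> real A * real B ^ 2"
      using B x4 by (intro mult_left_mono power_mono) auto
    finally have "real (h * (D * ((m + n) * A + m * n * D))) < real (A * B * B)"
      by (simp add: k_def power2_eq_square algebra_simps)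
    then show ?thesis by (simp only: of_nat_less_iff)
  qed
  moreover have "m < A" "n < A" using A5 by simp_all
  moreover have "g * (A * B) \<le> t" using A1 by (simp add: ac_simps)
  ultimately show ?thesis using that B D At by blast
qed

section \<open>The bound over a field of large characteristic\<close>

text \<open>Lagrange's theorem in the form needed here: division by \<open>z\<close> permutes \<open>G\<close>, so the product of all
  elements of \<open>G\<close> is unchanged when divided by \<open>z ^ card G\<close>.\<close>

lemma power_card_eq_1:
  fixes G :: "'a::field set"
  assumes "finite G" "0 \<notin> G" and div: "\<And>u v. u \<in> G \<Longrightarrow> v \<in> G \<Longrightarrow> u / v \<in> G"
    and z: "z \<in> G"
  shows "z ^ card G = 1"
proof -
  have z0: "z \<noteq> 0" using assms by auto
  have "(\<lambda>u. u / z) ` G \<subseteq> G" using div z by auto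
  moreover have inj: "inj_on (\<lambda>u. u / z) G" using z0 by (auto intro: inj_onI)
  ultimately have "(\<lambda>u. u / z) ` G = G"
    using assms(1) by (simp add: endo_inj_surj)
  then have "prod (\<lambda>u. u) G = (\<Prod>u\<in>G. u / z)"
    using prod.reindex[OF inj, of "\<lambda>u. u"] by (simp add: o_def)
  also have "\<dots> = prod (\<lambda>u. u) G / z ^ card G" by (simp add: prod_dividef)
  finally have "prod (\<lambda>u. u) G * z ^ card G = prod (\<lambda>u. u) G" using z0 by (simp add: field_simps)
  moreover have "prod (\<lambda>u. u) G \<noteq> 0" using assms by auto
  ultimately show ?thesis by simp
qed

lemma of_nat_fact_nonzero:
  assumes "\<And>k. 0 < k \<Longrightarrow> k < p \<Longrightarrow> (of_nat k :: 'a::field) \<noteq> 0" "k < p"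
  shows "(of_nat (fact k) :: 'a) \<noteq> 0"
  using assms(2)
proof (induction k)
  case (Suc k)
  have "(of_nat (fact (Suc k)) :: 'a) = of_nat (Suc k) * of_nat (fact k)"
    by (simp only: fact_Suc of_nat_mult of_nat_id)
  then show ?case using Suc assms(1)[of "Suc k"] by (simp del: of_nat_Suc fact_Suc)
qed simp

text \<open>By bidegrees a quotient would be a constant \<open>c\<close>. Then every exponent of \<open>Y\<close> in \<open>P\<close> would equal \<open>c\<close>
  in the field, but two different exponents differ by less than \<open>p\<close>.\<close>

lemma not_dvd_euler_Y:
  fixes P :: "'a::field poly poly"
  assumes char: "\<And>k. 0 < k \<Longrightarrow> k < p \<Longrightarrow> (of_nat k :: 'a) \<noteq> 0"
    and P: "bideg_le m n P" "coeff (coeff P j0) m \<noteq> 0" "degree P = n" and np: "n < p"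
    and two: "coeff (coeff P j1) i1 \<noteq> 0" "coeff (coeff P j2) i2 \<noteq> 0" "j1 < j2"
  shows "\<not> P dvd euler_Y P"
proof
  assume "P dvd euler_Y P"
  then obtain r where r: "euler_Y P = P * r" by blast
  have "bideg_le (m + 0) (n + 0) (P * r)"
    unfolding r[symmetric] using bideg_le_euler_Y[OF P(1)] by simp
  then have "bideg_le 0 0 r" by (rule bideg_le_cofactor[OF P])
  then have deg0: "degree r = 0" "degree (coeff r 0) = 0" by (auto simp: bideg_le_def)
  from deg0(1) obtain s where s: "r = [:s:]" by (rule degree_eq_zeroE)
  with deg0(2) have "degree s = 0" by simp
  then obtain c where "s = [:c:]" by (rule degree_eq_zeroE)
  with s r have "euler_Y P = smult [:c:] P" by (simp add: mult.commute)
  then have "of_nat j * coeff (coeff P j) i = c * coeff (coeff P j) i" for i j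
    by (metis coeff_coeff_euler_Y coeff_smult mult_pCons_left smult_conv_map_poly coeff_pCons_0
        add.right_neutral mult_zero_left pCons_0_0)
  then have "of_nat j1 = c" "of_nat j2 = c" using two by (metis mult_right_cancel)+
  then have "(of_nat (j2 - j1) :: 'a) = 0" using two(3) by (simp add: of_nat_diff)
  moreover have "j2 \<le> n" using bideg_leD[OF P(1) two(2)] by simp
  then have "0 < j2 - j1" "j2 - j1 < p" using two(3) np by linarith+
  ultimately show False using char by blast
qed

text \<open>The points where \<open>Y \<partial>P/\<partial>Y\<close> is nonzero are counted by contact with the auxiliary polynomial and
  contribute at most \<open>8mn(m + n) g (ht)^(2/3)\<close>. The others are common zeros of \<open>P\<close> and
  \<open>Y \<partial>P/\<partial>Y\<close>, at most \<open>2mn\<close> in number. The hypothesis on \<open>w\<close> holds when \<open>g\<close> is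
  the greatest common divisor of the differences of total degrees in \<open>P\<close>.\<close>

theorem points_on_dilated_curves:
  fixes P :: "'a::field poly poly" and G :: "'a set" and l \<mu> :: "nat \<Rightarrow> 'a"
  assumes char: "\<And>k. 0 < k \<Longrightarrow> k < p \<Longrightarrow> (of_nat k :: 'a) \<noteq> 0"
    and prime: "prime_elem P"
    and P: "bideg_le m n P" "coeff (coeff P j0) m \<noteq> 0" "degree P = n"
    and low: "\<And>i j. coeff (coeff P j) i \<noteq> 0 \<Longrightarrow> d \<le> i + j"
    and low2: "coeff (coeff P j1) i1 \<noteq> 0" "coeff (coeff P j2) i2 \<noteq> 0"
      "i1 + j1 = d" "i2 + j2 = d" "j1 < j2"
    and g: "0 < g" "g \<le> m + n"
      "\<And>w::'a. w \<noteq> 0 \<Longrightarrow> \<exists>c. \<forall>i j. coeff (coeff P j) i \<noteq> 0 \<longrightarrow> w ^ (i + j) = c \<Longrightarrow> w ^ g = 1"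
    and G: "finite G" "card G = t" "0 \<notin> G" "\<And>u v. u \<in> G \<Longrightarrow> v \<in> G \<Longrightarrow> u / v \<in> G"
    and h: "1 \<le> h" and t: "real h ^ 2 \<le> real t" "threshold m n \<le> real t"
      "real t \<le> 1 / 2 * real p powr (3 / 4) * real h powr (- 1 / 4)"
    and nz: "\<And>i. i \<in> {1..h} \<Longrightarrow> l i \<noteq> 0 \<and> \<mu> i \<noteq> 0"
    and cosets: "\<And>i j u v. i \<in> {1..h} \<Longrightarrow> j \<in> {1..h} \<Longrightarrow> u \<in> G \<Longrightarrow> v \<in> G \<Longrightarrow>
      l i = l j * u \<Longrightarrow> \<mu> i = \<mu> j * v \<Longrightarrow> i = j"
  shows "real (\<Sum>i=1..h. card {(u, v) \<in> G \<times> G. eval_at (l i * u, \<mu> i * v) P = 0})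
    < 12 * real m * real n * (real m + real n) * real g * real h powr (2 / 3) * real t powr (2 / 3)"
proof -
  have i12: "i2 < i1" using low2(3-5) by linarith
  have "i1 \<le> m" "j2 \<le> n" using bideg_leD[OF P(1)] low2(1,2) by blast+
  then have mn: "1 \<le> m" "1 \<le> n" using i12 low2(5) by linarith+
  have "1 \<le> g" using g(1) by simp
  obtain A B D where ABD: "m < A" "n < A" "0 < B" "0 < D" "D \<le> p" "t < p"
    "h * (D * ((m + n) * A + m * n * D)) < A * B * B"
    "A \<le> t" "g * (A * B) \<le> t" "B * t \<le> p"
    "real (B * t) \<le> 8 * real (m * n * g) * (real h powr (2 / 3) * real t powr (2 / 3)) * real D"
    using stepanov_parameters[OF mn \<open>1 \<le> g\<close> g(2) h t] by blast
  have root: "z ^ t = 1" if "z \<in> G" for z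
    using power_card_eq_1[OF G(1,3,4) that] G(2) by simp
  define C where "C = (\<lambda>i. (l i ^ t, \<mu> i ^ t)) ` {1..h}"
  have C: "finite C" "card C \<le> h"
    unfolding C_def using card_image_le[of "{1..h}" "\<lambda>i. (l i ^ t, \<mu> i ^ t)"] by simp_all
  have "P \<noteq> 0" using P(2) by auto
  from auxiliary_polynomial_exists[OF P(1) this ABD(1,2) C ABD(7), of t]
  obtain w where w: "\<exists>s\<in>{..<A} \<times> {..<B} \<times> {..<B}. w s \<noteq> 0"
    "\<forall>x y. (x ^ t, y ^ t) \<in> C \<longrightarrow> eval_at (x, y) P = 0 \<longrightarrow>
       derivation_at.vanishes (curve_der P) (eval_at (x, y)) D (stepanov_poly t A B w)"
    by (elim exE conjE)
  define \<Psi> where "\<Psi> = stepanov_poly t A B w"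
  have ndvd: "\<not> P dvd \<Psi>" unfolding \<Psi>_def
    by (rule not_dvd_stepanov_poly[OF char prime P low low2(1-4) _ g(1,3) G(1-3) root ABD(8-10) w(1)])
       (use i12 in auto)
  define N where "N = A - 1 + (B - 1) * t"
  have b\<Psi>: "bideg_le N N \<Psi>"
    unfolding \<Psi>_def N_def using ABD by (intro bideg_le_stepanov_poly) auto
  have "N \<le> B * t" unfolding N_def using ABD(3,8) by (cases B) auto
  \<comment> \<open>the points of the \<open>h\<close> curves, moved to the one curve \<open>P = 0\<close>\<close>
  define pts where "pts i = {(u, v) \<in> G \<times> G. eval_at (l i * u, \<mu> i * v) P = 0}" for i
  define \<phi> where "\<phi> i = (\<lambda>(u, v). (l i * u, \<mu> i * v))" for i
  define S where "S = (\<Union>i\<in>{1..h}. \<phi> i ` pts i)"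
  have fin: "finite (pts i)" for i
    unfolding pts_def by (rule finite_subset[of _ "G \<times> G"]) (use G(1) in auto)
  have inj: "inj_on (\<phi> i) (pts i)" if "i \<in> {1..h}" for i
    using nz[OF that] by (auto simp: \<phi>_def inj_on_def)
  have "card S = (\<Sum>i=1..h. card (\<phi> i ` pts i))"
    unfolding S_def
  proof (rule card_UN_disjoint)
    show "\<forall>i\<in>{1..h}. \<forall>j\<in>{1..h}. i \<noteq> j \<longrightarrow> \<phi> i ` pts i \<inter> \<phi> j ` pts j = {}"
    proof (intro ballI impI, rule ccontr)
      fix i j assume ij: "i \<in> {1..h}" "j \<in> {1..h}" "i \<noteq> j" "\<phi> i ` pts i \<inter> \<phi> j ` pts j \<noteq> {}"
      then obtain u v u' v' where uv: "u \<in> G" "v \<in> G" "u' \<in> G" "v' \<in> G"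
        "l i * u = l j * u'" "\<mu> i * v = \<mu> j * v'"
        by (auto simp: \<phi>_def pts_def)
      moreover from this have "u \<noteq> 0" "v \<noteq> 0" using G(3) by auto
      ultimately have "l i = l j * (u' / u)" "\<mu> i = \<mu> j * (v' / v)" by (simp_all add: field_simps)
      then have "i = j" using cosets[OF ij(1,2)] G(4) uv by blast
      then show False using ij by simp
    qed
  qed (use fin in auto)
  also have "\<dots> = (\<Sum>i=1..h. card (pts i))" using inj by (simp add: card_image)
  finally have cardS: "card S = (\<Sum>i=1..h. card (pts i))" .
  have finS: "finite S" using fin by (simp add: S_def)
  have S: "eval_at q P = 0 \<and> (fst q ^ t, snd q ^ t) \<in> C \<and> fst q \<noteq> 0" if q: "q \<in> S" for q
  proof -
    obtain i u v where i: "i \<in> {1..h}" "u \<in> G" "v \<in> G" "eval_at q P = 0" "q = (l i * u, \<mu> i * v)"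
      using q by (auto simp: S_def \<phi>_def pts_def)
    then have "(fst q ^ t, snd q ^ t) = (l i ^ t, \<mu> i ^ t)" using root by (simp add: power_mult_distrib)
    then show ?thesis using i nz[OF i(1)] G(3) by (auto simp: C_def)
  qed
  define S1 where "S1 = {q \<in> S. eval_at q (euler_Y P) \<noteq> 0}"
  define S2 where "S2 = {q \<in> S. eval_at q (euler_Y P) = 0}"
  have "D * card S1 \<le> m * N + n * N"
  proof (rule contact_order_bound[OF prime P b\<Psi> ndvd])
    fix q assume q: "q \<in> S1"
    then have qS: "q \<in> S" by (simp add: S1_def)
    show "eval_at q P = 0" using S[OF qS] by simp
    show "derivation_at.vanishes (curve_der P) (eval_at q) D \<Psi>"
      using w(2)[rule_format, of "fst q" "snd q"] S[OF qS] by (simp add: \<Psi>_def)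
    show "of_nat (fact k) * (fst q * eval_at q (euler_Y P)) ^ k \<noteq> 0" if "k < D" for k
    proof -
      have "(of_nat (fact k) :: 'a) \<noteq> 0"
        by (rule of_nat_fact_nonzero[where p = p]) (use char that ABD(5) in auto)
      then show ?thesis using S[OF qS] q by (simp add: S1_def)
    qed
  qed (use finS in \<open>simp add: S1_def\<close>)
  also have "\<dots> \<le> (m + n) * (B * t)"
    using \<open>N \<le> B * t\<close> by (simp add: distrib_right add_mono)
  finally have "real (D * card S1) \<le> real ((m + n) * (B * t))" by (simp only: of_nat_le_iff)
  define Z where "Z = real h powr (2 / 3) * real t powr (2 / 3)"
  have "real D * real (card S1) \<le> real (m + n) * real (B * t)"
    using \<open>real (D * card S1) \<le> _\<close> by (simp only: of_nat_mult)
  also have "\<dots> \<le> real (m + n) * (8 * real (m * n * g) * Z * real D)"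
    using ABD(11) unfolding Z_def by (intro mult_left_mono) auto
  finally have "real D * real (card S1) \<le> real D * (8 * real (m * n * g) * real (m + n) * Z)"
    by (simp add: ac_simps)
  then have S1: "real (card S1) \<le> 8 * real (m * n * g) * real (m + n) * Z"
    using ABD(4) by (simp only: mult_le_cancel_left_pos of_nat_0_less_iff)
  have "n \<le> t"
    using ABD(2,8) by linarith
  have "1 * card S2 \<le> m * n + n * m"
  proof (rule contact_order_bound[OF prime P bideg_le_euler_Y[OF P(1)]])
    show "\<not> P dvd euler_Y P"
      by (rule not_dvd_euler_Y[OF char P _ low2(1,2,5)]) (use \<open>n \<le> t\<close> ABD(6) in auto)
    fix q assume q: "q \<in> S2"
    show "eval_at q P = 0" using S[of q] q by (simp add: S2_def)
    interpret q: derivation_at "curve_der P" "eval_at q" by (rule derivation_at_curve)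
    show "q.vanishes 1 (euler_Y P)" using q by (simp add: S2_def q.vanishes_Suc)
  qed (use finS in \<open>auto simp: S2_def\<close>)
  then have "real (card S2) \<le> real (m * n + n * m)" by (simp only: mult_1 of_nat_le_iff)
  then have S2: "real (card S2) \<le> 2 * real (m * n)" by simp
  have Z1: "1 \<le> Z"
  proof -
    have "1 \<le> real h" "1 \<le> real t" using h ABD(1,8) by simp_all
    then have "1 \<le> real h powr (2 / 3)" "1 \<le> real t powr (2 / 3)" by (simp_all add: ge_one_powr_ge_zero)
    then show ?thesis unfolding Z_def using mult_mono[of 1 _ 1] by fastforce
  qed
  have "S = S1 \<union> S2" "S1 \<inter> S2 = {}" by (auto simp: S1_def S2_def)
  then have "card S = card S1 + card S2" using finS by (metis card_Un_disjoint finite_Un)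
  then have "real (card S) \<le> 8 * real (m * n * g) * real (m + n) * Z + 2 * real (m * n)"
    using S1 S2 by simp
  also have "\<dots> < 12 * real (m * n * g) * real (m + n) * Z"
  proof -
    define Y where "Y = real g * (real (m + n) * Z)"
    have "1 * (1 * 1) \<le> Y"
      unfolding Y_def using g(1) mn Z1 by (intro mult_mono) auto
    then have "2 < 4 * Y" by simp
    then have less: "real (m * n) * 2 < real (m * n) * (4 * Y)"
      by (rule mult_strict_left_mono) (use mn in simp)
    have eq: "k * real (m * n * g) * real (m + n) * Z = k * (real (m * n) * Y)" for k :: real
      by (simp add: Y_def ac_simps)
    show ?thesis unfolding eq using less by linarith
  qed
  finally show ?thesis unfolding cardS pts_def Z_def by (simp add: ac_simps)
qed

section \<open>Polynomials over a ring given by a carrier\<close>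

text \<open>A bijection \<open>rep\<close> from a type onto the carrier of a ring that respects the operations. It passes to
  polynomials (\<open>poly_model\<close> below), so that two applications reach bivariate polynomials.\<close>

locale cring_model = R: cring R for R :: "('b, 'c) ring_scheme" (structure) +
  fixes rep :: "'a::comm_ring_1 \<Rightarrow> 'b"
  assumes bij: "bij_betw rep UNIV (carrier R)"
    and rep_add: "rep (x + y) = rep x \<oplus> rep y"
    and rep_mult: "rep (x * y) = rep x \<otimes> rep y"
    and rep_1: "rep 1 = \<one>"
begin

lemma rep_closed [simp]: "rep x \<in> carrier R"
  using bij by (auto simp: bij_betw_def)

lemma rep_inj [simp]: "rep x = rep y \<longleftrightarrow> x = y"
  using bij by (auto simp: bij_betw_def inj_eq)

lemma rep_surj: "y \<in> carrier R \<Longrightarrow> \<exists>x. rep x = y"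
  using bij by (metis bij_betw_def imageE)

lemma rep_0: "rep 0 = \<zero>"
proof -
  have "rep 0 \<oplus> rep 0 = rep 0" by (simp flip: rep_add)
  then show ?thesis by simp
qed

lemma rep_eq_zero_iff [simp]: "rep x = \<zero> \<longleftrightarrow> x = 0"
  using rep_inj[of x 0] by (simp add: rep_0 del: rep_inj)

lemma rep_power: "rep (x ^ k) = rep x [^] k"
  by (induction k) (simp_all add: rep_1 rep_mult R.m_comm)

lemma rep_sum: "finite A \<Longrightarrow> rep (sum f A) = (\<Oplus>i\<in>A. rep (f i))"
  by (induction A rule: finite_induct) (simp_all add: rep_0 rep_add)

lemma rep_mem_Units_iff: "rep x \<in> Units R \<longleftrightarrow> x dvd 1"
proof
  assume "rep x \<in> Units R"
  then obtain y where "y \<in> carrier R" "rep x \<otimes> y = \<one>" by (auto simp: Units_def)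
  then obtain z where "rep x \<otimes> rep z = \<one>" using rep_surj by blast
  then have "x * z = 1" by (metis rep_1 rep_inj rep_mult)
  then show "x dvd 1" by (metis dvd_triv_left)
next
  assume "x dvd 1"
  then obtain z where "x * z = 1" by (metis dvd_def)
  then have "rep x \<otimes> rep z = \<one>" by (metis rep_1 rep_mult)
  then show "rep x \<in> Units R" unfolding Units_def by (auto simp: R.m_comm intro!: bexI[of _ "rep z"])
qed

end

lemma (in cring_model) irreducible_transfer:
  fixes x :: 'a
  assumes no_zero_div: "\<And>x y :: 'a. x * y = 0 \<Longrightarrow> x = 0 \<or> y = 0"
    and irr: "ring_irreducible\<^bsub>R\<^esub> (rep x)"
  shows "Factorial_Ring.irreducible x"
  unfolding Factorial_Ring.irreducible_def
proof (intro conjI allI impI)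
  show x0: "x \<noteq> 0" using irr by (auto simp: ring_irreducible_def rep_0)
  show "\<not> x dvd 1" using irr
    by (auto simp: ring_irreducible_def Divisibility.irreducible_def rep_mem_Units_iff)
  fix a b assume ab: "x = a * b"
  show "a dvd 1 \<or> b dvd 1"
  proof (cases "rep x divides\<^bsub>R\<^esub> rep a")
    case True
    then obtain c where "c \<in> carrier R" "rep a = rep x \<otimes> c" by (auto simp: factor_def)
    then obtain d where "rep a = rep x \<otimes> rep d" using rep_surj by blast
    then have "a = x * d" by (metis rep_inj rep_mult)
    then have "a * (1 - b * d) = 0" using ab by (simp add: algebra_simps)
    then have "b * d = 1" using no_zero_div[of a "1 - b * d"] x0 ab by auto
    then show ?thesis by (metis dvd_triv_left)
  next
    case False
    have "rep a divides\<^bsub>R\<^esub> rep x" unfolding factor_def using ab rep_mult by auto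
    with False have "properfactor R (rep a) (rep x)" by (simp add: properfactor_def)
    then show ?thesis
      using irr by (auto simp: ring_irreducible_def Divisibility.irreducible_def rep_mem_Units_iff)
  qed
qed

definition poly_rep :: "('a::zero \<Rightarrow> 'b) \<Rightarrow> 'a poly \<Rightarrow> nat \<Rightarrow> 'b" where
  "poly_rep rep f = (\<lambda>i. rep (coeff f i))"

context cring_model
begin

lemma UP_cring: "UP_cring R"
  by (simp add: UP_cring_def R.is_cring)

lemma poly_rep_in_up: "poly_rep rep f \<in> up R"
proof (rule mem_upI)
  have "bound \<zero> (degree f) (poly_rep rep f)"
    by (rule bound.intro) (simp add: poly_rep_def coeff_eq_0)
  then show "\<exists>n. bound \<zero> n (poly_rep rep f)" by blast
qed (simp add: poly_rep_def)

lemma poly_rep_surj: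
  assumes "q \<in> up R"
  shows "\<exists>f. poly_rep rep f = q"
proof -
  obtain n where n: "bound \<zero> n q" using assms by (auto simp: up_def)
  define c where "c i = (SOME x. rep x = q i)" for i
  have c: "rep (c i) = q i" for i
    unfolding c_def by (rule someI_ex) (use assms rep_surj in \<open>auto dest: mem_upD\<close>)
  define f where "f = (\<Sum>i\<le>n. Polynomial.monom (c i) i)"
  have "rep (coeff f i) = q i" for i
  proof (cases "i \<le> n")
    case True
    then have "coeff f i = c i" by (simp add: f_def coeff_sum)
    then show ?thesis by (simp add: c)
  next
    case False
    then have "coeff f i = 0" by (auto simp: f_def coeff_sum intro!: sum.neutral)
    then show ?thesis using bound.bound[OF n, of i] False by (simp add: rep_0)
  qed
  then show ?thesis by (auto simp: poly_rep_def)
qed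

lemma coeff_poly_rep: "UnivPoly.coeff (UP R) (poly_rep rep f) i = rep (coeff f i)"
  using poly_rep_in_up by (simp add: UP_def poly_rep_def)

lemma deg_poly_rep: "deg R (poly_rep rep f) = degree f"
proof -
  have "bound \<zero> n (UnivPoly.coeff (UP R) (poly_rep rep f)) \<longleftrightarrow> (\<forall>i>n. coeff f i = 0)" for n
    by (auto simp: bound_def coeff_poly_rep)
  then show ?thesis by (simp add: deg_def degree_def)
qed

lemma eval_poly_rep:
  assumes "cring_model S rep'" "\<And>x. \<phi> (rep x) = rep' (\<psi> x)"
  shows "eval R S \<phi> (rep' s) (poly_rep rep f) = rep' (\<Sum>i\<le>degree f. \<psi> (coeff f i) * s ^ i)"
proof -
  interpret S: cring_model S rep' by (rule assms)
  have "poly_rep rep f \<in> carrier (UP R)" using poly_rep_in_up by (simp add: UP_def)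
  then show ?thesis
    by (simp add: eval_def deg_poly_rep coeff_poly_rep assms(2) S.rep_sum S.rep_mult S.rep_power)
qed

lemma poly_model: "cring_model (UP R) (poly_rep rep)"
proof -
  interpret UP: UP_cring R "UP R" by (rule UP_cring)
  show ?thesis
  proof (unfold cring_model_def cring_model_axioms_def, intro conjI allI)
    show "cring (UP R)" by (rule UP.UP_cring)
    have "inj (poly_rep rep)" by (rule injI) (metis coeff_poly_rep poly_eqI rep_inj)
    moreover have "range (poly_rep rep) = carrier (UP R)"
      using poly_rep_in_up poly_rep_surj by (auto simp: UP_def) (metis rangeI)
    ultimately show "bij_betw (poly_rep rep) UNIV (carrier (UP R))" by (simp add: bij_betw_def)
    show "poly_rep rep (f + g) = poly_rep rep f \<oplus>\<^bsub>UP R\<^esub> poly_rep rep g" for f g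
      using poly_rep_in_up by (simp add: UP_def poly_rep_def rep_add)
    show "poly_rep rep (f * g) = poly_rep rep f \<otimes>\<^bsub>UP R\<^esub> poly_rep rep g" for f g
      using poly_rep_in_up by (simp add: UP_def poly_rep_def coeff_mult rep_sum rep_mult)
    show "poly_rep rep 1 = \<one>\<^bsub>UP R\<^esub>"
      by (auto simp: UP_def poly_rep_def rep_1 rep_0)
  qed
qed

end

section \<open>Transfer of the bound\<close>

definition bipoly_rep :: "('a::zero \<Rightarrow> 'b) \<Rightarrow> 'a poly poly \<Rightarrow> nat \<Rightarrow> nat \<Rightarrow> 'b" where
  "bipoly_rep rep = poly_rep (poly_rep rep)"

locale field_model = cring_model K rep
  for K :: "('b, 'c) ring_scheme" (structure) and rep :: "'a::field \<Rightarrow> 'b"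
begin

lemma biv_model: "cring_model (biv K) (bipoly_rep rep)"
  unfolding biv_def bipoly_rep_def by (intro cring_model.poly_model poly_model)

lemma bcoeff_bipoly_rep: "bcoeff K (bipoly_rep rep f) i j = rep (coeff (coeff f j) i)"
  unfolding bcoeff_def biv_def bipoly_rep_def
  by (simp add: cring_model.coeff_poly_rep[OF poly_model] coeff_poly_rep)

lemma bipoly_rep_apply: "bipoly_rep rep f j i = rep (coeff (coeff f j) i)"
  by (simp add: bipoly_rep_def poly_rep_def)

lemma deg_Y_bipoly_rep: "deg_Y K (bipoly_rep rep f) = degree f"
  unfolding deg_Y_def bipoly_rep_def by (rule cring_model.deg_poly_rep[OF poly_model])

lemma deg_X_bipoly_rep:
  "deg_X K (bipoly_rep rep f) = Max ((\<lambda>j. degree (coeff f j)) ` {..degree f})"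
  unfolding deg_X_def deg_Y_bipoly_rep
  by (simp add: bipoly_rep_def biv_def cring_model.coeff_poly_rep[OF poly_model] deg_poly_rep)

lemma beval_bipoly_rep: "beval K (bipoly_rep rep f) (rep u) (rep v) = rep (eval_at (u, v) f)"
proof -
  have "eval K K (\<lambda>c. c) (rep u) (poly_rep rep c) = rep (poly c u)" for c
    using eval_poly_rep[OF cring_model_axioms, of "\<lambda>c. c" "\<lambda>c. c" u c] by (simp add: poly_altdef)
  then have "beval K (bipoly_rep rep f) (rep u) (rep v)
      = rep (\<Sum>j\<le>degree f. poly (coeff f j) u * v ^ j)"
    unfolding beval_def bipoly_rep_def
    by (rule cring_model.eval_poly_rep[OF poly_model cring_model_axioms])
  also have "(\<Sum>j\<le>degree f. poly (coeff f j) u * v ^ j) = eval_at (u, v) f"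
    by (simp add: eval_at_def poly_altdef[of f] poly_sum)
  finally show ?thesis .
qed

lemma bscale_bipoly_rep:
  "bscale K (rep a) (rep b) (bipoly_rep rep f) = bipoly_rep rep (rescale a b f)"
  by (intro ext) (simp add: bscale_def bcoeff_bipoly_rep bipoly_rep_apply coeff_rescale
      mult.commute rep_mult[symmetric] rep_power[symmetric] mult.assoc mult.left_commute)

lemma bsupp_bipoly_rep: "bsupp K (bipoly_rep rep f) = {(i, j). coeff (coeff f j) i \<noteq> 0}"
  by (simp add: bsupp_def bcoeff_bipoly_rep)

text \<open>The lowest form has to be seen as a polynomial first: outside the carrier the coefficient function
  is unspecified.\<close>

lemma bsupp_sharp:
  "bsupp K (sharp K (bipoly_rep rep f))
    = {(i, j). coeff (coeff f j) i \<noteq> 0 \<and> i + j = dsharp K (bipoly_rep rep f)}"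
proof -
  define d where "d = dsharp K (bipoly_rep rep f)"
  define P where "P = sharp K (bipoly_rep rep f)"
  have P: "P j i = (if i + j = d then rep (coeff (coeff f j) i) else \<zero>)" for i j
    by (simp add: P_def sharp_def d_def bcoeff_bipoly_rep)
  have up1: "P j \<in> up K" for j
  proof (rule mem_upI)
    have "bound \<zero> d (P j)" by (rule bound.intro) (simp add: P)
    then show "\<exists>n. bound \<zero> n (P j)" by blast
  qed (simp add: P)
  have "P \<in> up (UP K)"
  proof (rule mem_upI)
    have "bound \<zero>\<^bsub>UP K\<^esub> d P" by (rule bound.intro) (auto simp: P UP_def)
    then show "\<exists>n. bound \<zero>\<^bsub>UP K\<^esub> n P" by blast
  qed (use up1 in \<open>simp add: UP_def\<close>)
  then have "UnivPoly.coeff (biv K) P j = P j" for j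
    unfolding biv_def by (subst UP_def) simp
  then have "bcoeff K P i j = P j i" for i j
    unfolding bcoeff_def using up1 by (simp add: UP_def)
  then show ?thesis unfolding P_def[symmetric] d_def[symmetric] bsupp_def by (auto simp: P)
qed

lemma finite_support: "finite {(i, j). coeff (coeff f j) i \<noteq> 0}" for f :: "'a poly poly"
proof -
  obtain d where d: "bideg_le d d f" using bideg_le_ex by blast
  show ?thesis by (rule finite_subset[of _ "{..d} \<times> {..d}"]) (auto dest: bideg_leD[OF d])
qed

lemma dsharp_le:
  "coeff (coeff f j) i \<noteq> 0 \<Longrightarrow> dsharp K (bipoly_rep rep f) \<le> i + j"
  unfolding dsharp_def bsupp_bipoly_rep by (rule Min_le) (use finite_support in auto)

text \<open>If the two pairs of dilations lie in the same cosets, the scalar \<open>1\<close> witnesses dependence.\<close>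

lemma dependent_of_same_cosets:
  assumes "u \<in> G" "v \<in> G" "l = l' * u" "\<mu> = \<mu>' * v" and G: "rep ` G \<subseteq> H"
  shows "\<not> G_independent K H (bscale K (rep l) (rep \<mu>) (bipoly_rep rep f))
    (bscale K (rep l') (rep \<mu>') (bipoly_rep rep f))"
proof -
  interpret UP: UP_cring K "UP K" by (rule UP_cring)
  interpret UP2: UP_cring "UP K" "biv K"
    unfolding biv_def by (simp add: UP_cring_def UP.UP_cring)
  define Q where "Q = bscale K (rep u) (rep v) (bscale K (rep l') (rep \<mu>') (bipoly_rep rep f))"
  have Q: "Q = bipoly_rep rep (rescale u v (rescale l' \<mu>' f))"
    by (simp add: Q_def bscale_bipoly_rep)
  also have "rescale u v (rescale l' \<mu>' f) = rescale l \<mu> f"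
    by (intro poly_eqI) (simp add: coeff_rescale assms power_mult_distrib)
  finally have "bscale K (rep l) (rep \<mu>) (bipoly_rep rep f) = Q"
    by (simp add: bscale_bipoly_rep)
  also have "Q \<in> carrier (biv K)" unfolding Q by (rule cring_model.rep_closed[OF biv_model])
  then have "Q = UnivPoly.monom (UP K) \<one> 0 \<odot>\<^bsub>biv K\<^esub> Q"
    by (simp add: UP.monom_one)
  finally have eq: "bscale K (rep l) (rep \<mu>) (bipoly_rep rep f)
      = UnivPoly.monom (UP K) \<one> 0 \<odot>\<^bsub>biv K\<^esub> Q" .
  have "rep u \<in> H" "rep v \<in> H" using assms(1,2) G by auto
  moreover have "\<one> \<in> carrier K - {\<zero>}" using rep_1 rep_eq_zero_iff[of 1] by simp
  ultimately show ?thesis unfolding G_independent_def using eq[unfolded Q_def] by blast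
qed

end

text \<open>The order of \<open>w\<close> divides every element of \<open>S\<close>, hence their greatest common divisor.\<close>

lemma power_Gcd_eq_1:
  fixes w :: "'a::field" and S :: "int set"
  assumes "\<And>x. x \<in> S \<Longrightarrow> w ^ nat \<bar>x\<bar> = 1"
  shows "w ^ nat (Gcd S) = 1"
proof (cases "S \<subseteq> {0}")
  case True
  then have "Gcd S = 0" by (simp only: Gcd_0_iff)
  then show ?thesis by (metis nat_0 power_0)
next
  case False
  then obtain x where "x \<in> S" "x \<noteq> 0" by auto
  then have ex: "0 < nat \<bar>x\<bar> \<and> w ^ nat \<bar>x\<bar> = 1" using assms by simp
  define r where "r = (LEAST k. 0 < k \<and> w ^ k = 1)"
  have r: "0 < r" "w ^ r = 1" unfolding r_def using LeastI[where P = "\<lambda>k. 0 < k \<and> w ^ k = 1", OF ex] by auto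
  have dvd: "r dvd k" if "w ^ k = 1" for k
  proof (rule ccontr)
    assume "\<not> r dvd k"
    then have "0 < k mod r" by (simp add: mod_greater_zero_iff_not_dvd)
    moreover have "w ^ (k mod r) = 1"
    proof -
      have "w ^ k = (w ^ r) ^ (k div r) * w ^ (k mod r)"
        by (metis mult_div_mod_eq power_add power_mult)
      then show ?thesis using that r(2) by simp
    qed
    ultimately have "r \<le> k mod r" unfolding r_def by (intro Least_le) simp
    then show False using mod_less_divisor[OF r(1), of k] by linarith
  qed
  have "int r dvd Gcd S"
  proof (rule Gcd_greatest)
    fix x assume "x \<in> S"
    then have "r dvd nat \<bar>x\<bar>" using assms dvd by blast
    then show "int r dvd x" by (simp add: dvd_nat_abs_iff)
  qed
  then obtain k where "Gcd S = int r * k" by blast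
  then have "nat (Gcd S) = r * nat k" by (simp add: nat_mult_distrib)
  then show ?thesis using r(2) by (simp add: power_mult)
qed

text \<open>The claim for one field and one prime, separated out so that it can be carried from one
  prime to the others.\<close>

definition point_bound_holds :: "('a, 'b) ring_scheme \<Rightarrow> nat \<Rightarrow> bool" where
  "point_bound_holds K p \<longleftrightarrow> (\<forall>m n P. P \<in> carrier (biv K) \<and> ring_irreducible\<^bsub>biv K\<^esub> P \<and>
      deg_X K P = m \<and> deg_Y K P = n \<and> card (bsupp K (sharp K P)) \<ge> 2 \<and> exp_gcd K P \<noteq> 0 \<longrightarrow>
    (\<forall>G t h l \<mu>. subgroup G (units_of K) \<and> finite G \<and> card G = t \<and> h \<ge> 1 \<and>
        1 / 2 * real p powr (3 / 4) * real h powr (- 1 / 4) \<ge> real t \<and>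
        real t \<ge> max (real h ^ 2) (threshold m n) \<and>
        (\<forall>k\<in>{1..h}. l k \<in> carrier K - {\<zero>\<^bsub>K\<^esub>} \<and> \<mu> k \<in> carrier K - {\<zero>\<^bsub>K\<^esub>}) \<and>
        (\<forall>i\<in>{1..h}. \<forall>j\<in>{1..h}. i \<noteq> j \<longrightarrow>
           G_independent K G (bscale K (l i) (\<mu> i) P) (bscale K (l j) (\<mu> j) P)) \<longrightarrow>
      real (\<Sum>i=1..h. card {(u, v) \<in> G \<times> G.
            beval K (bscale K (l i) (\<mu> i) P) u v = \<zero>\<^bsub>K\<^esub>})
        < 12 * real m * real n * (real m + real n) * real_of_int (exp_gcd K P)
            * real h powr (2 / 3) * real t powr (2 / 3)))"

lemma (in field_model) exp_gcd_bipoly_rep: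
  "exp_gcd K (bipoly_rep rep f) = Gcd {int i1 + int j1 - int i2 - int j2 | i1 j1 i2 j2.
     coeff (coeff f j1) i1 \<noteq> 0 \<and> coeff (coeff f j2) i2 \<noteq> 0}"
  unfolding exp_gcd_def bcoeff_bipoly_rep rep_mult[symmetric] rep_eq_zero_iff mult_eq_0_iff de_Morgan_disj ..

lemma (in field_model) exp_gcd_power_eq_1:
  assumes w: "w \<noteq> (0::'a)" "\<forall>i j. coeff (coeff f j) i \<noteq> 0 \<longrightarrow> w ^ (i + j) = c"
  shows "w ^ nat (exp_gcd K (bipoly_rep rep f)) = 1"
  unfolding exp_gcd_bipoly_rep
proof (rule power_Gcd_eq_1)
  have *: "w ^ (a - b) = 1" if "b \<le> a" "w ^ a = w ^ b" for a b
    using w(1) that by (simp add: power_diff)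
  fix x assume "x \<in> {int i1 + int j1 - int i2 - int j2 | i1 j1 i2 j2.
     coeff (coeff f j1) i1 \<noteq> 0 \<and> coeff (coeff f j2) i2 \<noteq> 0}"
  then obtain i1 j1 i2 j2 where x: "x = int (i1 + j1) - int (i2 + j2)"
    and nz: "coeff (coeff f j1) i1 \<noteq> 0" "coeff (coeff f j2) i2 \<noteq> 0" by (auto simp: algebra_simps)
  have eq: "w ^ (i1 + j1) = w ^ (i2 + j2)" using w(2) nz by metis
  show "w ^ nat \<bar>x\<bar> = 1"
  proof (cases "i2 + j2 \<le> i1 + j1")
    case True
    then have "nat \<bar>x\<bar> = (i1 + j1) - (i2 + j2)" by (simp add: x)
    then show ?thesis using *[OF True eq] by simp
  next
    case False
    then have "nat \<bar>x\<bar> = (i2 + j2) - (i1 + j1)" by (simp add: x)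
    then show ?thesis using *[of "i1 + j1" "i2 + j2"] False eq by simp
  qed
qed

lemma (in field_model) exp_gcd_le:
  assumes "bideg_le m n f" "exp_gcd K (bipoly_rep rep f) \<noteq> 0"
  shows "nat (exp_gcd K (bipoly_rep rep f)) \<le> m + n"
proof -
  define S where "S = {int i1 + int j1 - int i2 - int j2 | i1 j1 i2 j2.
     coeff (coeff f j1) i1 \<noteq> 0 \<and> coeff (coeff f j2) i2 \<noteq> 0}"
  have g: "exp_gcd K (bipoly_rep rep f) = Gcd S" by (simp add: exp_gcd_bipoly_rep S_def)
  with assms(2) have "\<not> S \<subseteq> {0}" by (simp add: Gcd_0_iff)
  then obtain x where x: "x \<in> S" "x \<noteq> 0" by blast
  then obtain i1 j1 i2 j2 where *: "x = int i1 + int j1 - int i2 - int j2"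
    "coeff (coeff f j1) i1 \<noteq> 0" "coeff (coeff f j2) i2 \<noteq> 0" by (auto simp: S_def)
  then have "\<bar>x\<bar> \<le> int (m + n)"
    using bideg_leD[OF assms(1) *(2)] bideg_leD[OF assms(1) *(3)] by auto
  moreover have "Gcd S dvd x" using x by (simp add: Gcd_dvd)
  then have "Gcd S \<le> \<bar>x\<bar>" using x(2) by (simp add: dvd_imp_le_int zdvd_imp_le)
  ultimately show ?thesis by (simp add: g)
qed

lemma point_bound_of_model:
  fixes rep :: "'a::field_gcd \<Rightarrow> 'b"
  assumes model: "field_model K rep"
    and char: "\<And>k. 0 < k \<Longrightarrow> k < p \<Longrightarrow> (of_nat k :: 'a) \<noteq> 0"
  shows "point_bound_holds K p"
  unfolding point_bound_holds_def
proof (intro allI impI, elim conjE)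
  interpret field_model K rep by (rule model)
  interpret biv: cring_model "biv K" "bipoly_rep rep" by (rule biv_model)
  fix m n P G t h l \<mu>
  assume PK: "P \<in> carrier (biv K)" and irr: "ring_irreducible\<^bsub>biv K\<^esub> P"
    and m: "deg_X K P = m" and n: "deg_Y K P = n"
    and two: "card (bsupp K (sharp K P)) \<ge> 2" and gcd: "exp_gcd K P \<noteq> 0"
    and sub: "subgroup G (units_of K)" and finG: "finite G" and cardG: "card G = t"
    and h: "1 \<le> h" and t1: "1 / 2 * real p powr (3 / 4) * real h powr (- 1 / 4) \<ge> real t"
    and t2: "real t \<ge> max (real h ^ 2) (threshold m n)"
    and nz: "\<forall>k\<in>{1..h}. l k \<in> carrier K - {\<zero>\<^bsub>K\<^esub>} \<and> \<mu> k \<in> carrier K - {\<zero>\<^bsub>K\<^esub>}"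
    and indep: "\<forall>i\<in>{1..h}. \<forall>j\<in>{1..h}. i \<noteq> j \<longrightarrow>
           G_independent K G (bscale K (l i) (\<mu> i) P) (bscale K (l j) (\<mu> j) P)"
  obtain f where f: "P = bipoly_rep rep f" using biv.rep_surj[OF PK] by blast
  have "Factorial_Ring.irreducible f"
    by (rule biv.irreducible_transfer) (use irr in \<open>auto simp: f\<close>)
  then have prime: "prime_elem f" by (rule irreducible_imp_prime_elem)
  have degf: "degree f = n" using n by (simp add: f deg_Y_bipoly_rep)
  have mMax: "m = Max ((\<lambda>j. degree (coeff f j)) ` {..degree f})"
    using m by (simp add: f deg_X_bipoly_rep)
  have "degree (coeff f j) \<le> m" for j
  proof (cases "j \<le> degree f")
    case True
    then show ?thesis unfolding mMax by (intro Max_ge) auto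
  qed (simp add: coeff_eq_0)
  then have bdeg: "bideg_le m n f" by (simp add: bideg_le_def degf)
  obtain s1 s2 where s: "s1 \<in> bsupp K (sharp K P)" "s2 \<in> bsupp K (sharp K P)" "s1 \<noteq> s2"
    using two by (metis (no_types, lifting) card_le_Suc0_iff_eq card.infinite not_less_eq_eq
        numeral_2_eq_2 zero_le)
  define d where "d = dsharp K P"
  have supp: "(i, j) \<in> bsupp K (sharp K P) \<longleftrightarrow> coeff (coeff f j) i \<noteq> 0 \<and> i + j = d" for i j
    by (simp add: f bsupp_sharp d_def)
  have s12: "coeff (coeff f (snd s1)) (fst s1) \<noteq> 0" "fst s1 + snd s1 = d"
    "coeff (coeff f (snd s2)) (fst s2) \<noteq> 0" "fst s2 + snd s2 = d"
    using s(1,2) supp[of "fst s1" "snd s1"] supp[of "fst s2" "snd s2"] by simp_all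
  obtain i1 j1 i2 j2 where low: "coeff (coeff f j1) i1 \<noteq> 0" "coeff (coeff f j2) i2 \<noteq> 0"
    "i1 + j1 = d" "i2 + j2 = d" "j1 < j2"
  proof (cases "snd s1 < snd s2")
    case True
    then show ?thesis using that[of "snd s1" "fst s1" "snd s2" "fst s2"] s12 by simp
  next
    case False
    moreover have "snd s1 \<noteq> snd s2"
    proof
      assume "snd s1 = snd s2"
      moreover from this have "fst s1 = fst s2" using s12(2,4) by simp
      ultimately show False using s(3) by (simp add: prod_eq_iff)
    qed
    ultimately show ?thesis
      using that[of "snd s2" "fst s2" "snd s1" "fst s1"] s12 by simp
  qed
  have "m \<in> (\<lambda>j. degree (coeff f j)) ` {..degree f}" unfolding mMax by (rule Max_in) auto
  then obtain j0 where j0: "degree (coeff f j0) = m" by auto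
  have "i2 < i1" using low by linarith
  moreover have "i1 \<le> m" using bideg_leD[OF bdeg low(1)] by simp
  ultimately have "coeff f j0 \<noteq> 0" using j0 by auto
  then have top: "coeff (coeff f j0) m \<noteq> 0" using j0 by auto
  define g where "g = nat (exp_gcd K P)"
  have gpos: "0 < g"
  proof -
    have "0 \<le> exp_gcd K P" unfolding exp_gcd_def by (rule Gcd_int_greater_eq_0)
    then show ?thesis using gcd by (simp add: g_def)
  qed
  define H where "H = {z. rep z \<in> G}"
  have GU: "G \<subseteq> Units K" using subgroup.subset[OF sub] by (simp add: units_of_carrier)
  have GH: "G = rep ` H"
  proof
    show "G \<subseteq> rep ` H"
    proof
      fix x assume "x \<in> G"
      moreover from this obtain z where "rep z = x" using GU rep_surj by (auto simp: Units_def)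
      ultimately show "x \<in> rep ` H" by (auto simp: H_def)
    qed
  qed (auto simp: H_def)
  have inj: "inj_on rep A" for A by (simp add: inj_on_def)
  have H: "finite H" "card H = t"
    using finG cardG inj unfolding GH by (simp_all add: finite_image_iff card_image)
  have H0: "0 \<notin> H"
  proof
    assume "0 \<in> H"
    then have "rep 0 \<in> Units K" using GU by (auto simp: H_def)
    then show False by (simp add: rep_mem_Units_iff)
  qed
  have Hdiv: "u / v \<in> H" if "u \<in> H" "v \<in> H" for u v
  proof -
    have v: "rep v \<in> G" "v \<noteq> 0" using that H0 by (auto simp: H_def)
    have iv: "inv\<^bsub>units_of K\<^esub> (rep v) \<in> G" by (rule subgroup.m_inv_closed[OF sub v(1)])
    then obtain y where y: "rep y = inv\<^bsub>units_of K\<^esub> (rep v)" using GH by auto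
    interpret U: group "units_of K" by (rule R.units_group)
    have "rep v \<otimes>\<^bsub>units_of K\<^esub> rep y = \<one>\<^bsub>units_of K\<^esub>"
      unfolding y by (rule U.r_inv) (use v GU in \<open>auto simp: units_of_carrier\<close>)
    then have "v * y = 1" by (metis rep_1 rep_inj rep_mult units_of_mult units_of_one)
    then have "y = 1 / v" using v(2) by (simp add: field_simps)
    moreover have "rep u \<otimes>\<^bsub>units_of K\<^esub> rep y \<in> G"
      by (rule subgroup.m_closed[OF sub]) (use that iv y in \<open>auto simp: H_def\<close>)
    ultimately show ?thesis by (simp add: H_def units_of_mult flip: rep_mult)
  qed
  have "\<forall>k\<in>{1..h}. \<exists>a b. l k = rep a \<and> \<mu> k = rep b \<and> a \<noteq> 0 \<and> b \<noteq> 0"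
    using nz rep_surj rep_0 by (metis DiffD1 DiffD2 singletonI)
  then obtain a b where ab: "\<And>k. k \<in> {1..h} \<Longrightarrow> l k = rep (a k) \<and> \<mu> k = rep (b k) \<and> a k \<noteq> 0 \<and> b k \<noteq> 0"
    by metis
  have pts: "card {(u, v) \<in> G \<times> G. beval K (bscale K (l i) (\<mu> i) P) u v = \<zero>\<^bsub>K\<^esub>}
      = card {(u, v) \<in> H \<times> H. eval_at (a i * u, b i * v) f = 0}" if i: "i \<in> {1..h}" for i
  proof -
    have "beval K (bscale K (l i) (\<mu> i) P) (rep u) (rep v) = rep (eval_at (a i * u, b i * v) f)" for u v
      using ab[OF i] by (simp add: f bscale_bipoly_rep beval_bipoly_rep eval_at_rescale)
    then have "{(u, v) \<in> G \<times> G. beval K (bscale K (l i) (\<mu> i) P) u v = \<zero>\<^bsub>K\<^esub>}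
        = map_prod rep rep ` {(u, v) \<in> H \<times> H. eval_at (a i * u, b i * v) f = 0}"
      unfolding GH by auto
    moreover have "inj_on (map_prod rep rep) {(u, v) \<in> H \<times> H. eval_at (a i * u, b i * v) f = 0}"
      by (auto simp: inj_on_def)
    ultimately show ?thesis by (simp add: card_image)
  qed
  have "real (\<Sum>i=1..h. card {(u, v) \<in> H \<times> H. eval_at (a i * u, b i * v) f = 0})
    < 12 * real m * real n * (real m + real n) * real g * real h powr (2 / 3) * real t powr (2 / 3)"
  proof (rule points_on_dilated_curves[OF char prime bdeg top degf _ low gpos _ _ H H0 Hdiv h])
    show "d \<le> i + j" if "coeff (coeff f j) i \<noteq> 0" for i j
      using dsharp_le[OF that] by (simp add: d_def f)
    show "g \<le> m + n" using exp_gcd_le[OF bdeg] gcd by (simp add: g_def f)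
    show "w ^ g = 1" if "w \<noteq> 0" "\<exists>c. \<forall>i j. coeff (coeff f j) i \<noteq> 0 \<longrightarrow> w ^ (i + j) = c" for w :: 'a
      using exp_gcd_power_eq_1 that unfolding g_def f by blast
    show "real h ^ 2 \<le> real t" "threshold m n \<le> real t" using t2 by simp_all
    show "real t \<le> 1 / 2 * real p powr (3 / 4) * real h powr (- 1 / 4)" by (rule t1)
    show "a i \<noteq> 0 \<and> b i \<noteq> 0" if "i \<in> {1..h}" for i using ab[OF that] by simp
    show "i = j" if ij: "i \<in> {1..h}" "j \<in> {1..h}" and uv: "u \<in> H" "v \<in> H"
      "a i = a j * u" "b i = b j * v" for i j u v
    proof (rule ccontr)
      assume "i \<noteq> j"
      then have "G_independent K G (bscale K (l i) (\<mu> i) P) (bscale K (l j) (\<mu> j) P)"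
        using indep ij by blast
      then show False
        using dependent_of_same_cosets[OF uv, of G f] ab[OF ij(1)] ab[OF ij(2)] GH f by simp
    qed
  qed
  also have "real g = real_of_int (exp_gcd K P)" using gpos by (simp add: g_def)
  finally show "real (\<Sum>i=1..h. card {(u, v) \<in> G \<times> G.
            beval K (bscale K (l i) (\<mu> i) P) u v = \<zero>\<^bsub>K\<^esub>})
        < 12 * real m * real n * (real m + real n) * real_of_int (exp_gcd K P)
            * real h powr (2 / 3) * real t powr (2 / 3)"
    using pts by simp
qed

section \<open>The algebraic closure as a type\<close>

lemma
  assumes "Factorial_Ring.prime p"
  shows field_Fp_bar: "field (Fp_bar p)"
    and Fp_bar_prime_field_hom: "ring.indexed_const (residue_ring (int p))
      \<in> ring_hom (residue_ring (int p)) (Fp_bar p)"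
proof -
  interpret R: residues_prime p "residue_ring (int p)"
    using assms by (simp add: residues_prime_def)
  show "field (Fp_bar p)"
    using R.alg_closureE(1) unfolding Fp_bar_def by (rule algebraic_closure.axioms)
  show "R.indexed_const \<in> ring_hom (residue_ring (int p)) (Fp_bar p)"
    unfolding Fp_bar_def by (rule R.alg_closureE(2))
qed

text \<open>A type cannot depend on a bound variable \<open>p\<close>. It is therefore built for one fixed prime, chosen as
  a counterexample to the bound if there is one. The bound for this single prime then implies it for
  all primes.\<close>

definition critical_prime :: nat where
  "critical_prime = (SOME p. Factorial_Ring.prime p \<and>
     (point_bound_holds (Fp_bar p) p \<longrightarrow>
       (\<forall>q. Factorial_Ring.prime q \<longrightarrow> point_bound_holds (Fp_bar q) q)))"

lemma critical_prime:
  shows prime_critical_prime: "Factorial_Ring.prime critical_prime"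
    and point_bound_from_critical_prime:
      "point_bound_holds (Fp_bar critical_prime) critical_prime \<Longrightarrow> Factorial_Ring.prime q \<Longrightarrow>
       point_bound_holds (Fp_bar q) q"
proof -
  define C where "C p \<longleftrightarrow> Factorial_Ring.prime p \<and>
     (point_bound_holds (Fp_bar p) p \<longrightarrow>
       (\<forall>q. Factorial_Ring.prime q \<longrightarrow> point_bound_holds (Fp_bar q) q))" for p
  have "\<exists>p. C p"
  proof (cases "\<forall>q. Factorial_Ring.prime q \<longrightarrow> point_bound_holds (Fp_bar q) q")
    case True
    then show ?thesis using two_is_prime_nat unfolding C_def by blast
  qed (auto simp: C_def)
  then have "C critical_prime" unfolding critical_prime_def C_def by (rule someI_ex)
  then show "Factorial_Ring.prime critical_prime"
    and "point_bound_holds (Fp_bar critical_prime) critical_prime \<Longrightarrow> Factorial_Ring.prime q \<Longrightarrow>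
       point_bound_holds (Fp_bar q) q"
    unfolding C_def by blast+
qed

typedef critical_field = "carrier (Fp_bar critical_prime)"
proof -
  interpret field "Fp_bar critical_prime" by (rule field_Fp_bar[OF prime_critical_prime])
  show ?thesis using zero_closed by blast
qed

setup_lifting type_definition_critical_field

instantiation critical_field :: field
begin

context
begin

interpretation field "Fp_bar critical_prime"
  by (rule field_Fp_bar[OF prime_critical_prime])

lift_definition zero_critical_field :: critical_field is "\<zero>\<^bsub>Fp_bar critical_prime\<^esub>"
  by (rule ring_simprules)

lift_definition one_critical_field :: critical_field is "\<one>\<^bsub>Fp_bar critical_prime\<^esub>"
  by (rule ring_simprules)

lift_definition plus_critical_field :: "critical_field \<Rightarrow> critical_field \<Rightarrow> critical_field"
  is "\<lambda>x y. x \<oplus>\<^bsub>Fp_bar critical_prime\<^esub> y"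
  by (rule ring_simprules)

lift_definition minus_critical_field :: "critical_field \<Rightarrow> critical_field \<Rightarrow> critical_field"
  is "\<lambda>x y. x \<ominus>\<^bsub>Fp_bar critical_prime\<^esub> y"
  by (rule ring_simprules)

lift_definition times_critical_field :: "critical_field \<Rightarrow> critical_field \<Rightarrow> critical_field"
  is "\<lambda>x y. x \<otimes>\<^bsub>Fp_bar critical_prime\<^esub> y"
  by (rule ring_simprules)

lift_definition uminus_critical_field :: "critical_field \<Rightarrow> critical_field"
  is "\<lambda>x. \<ominus>\<^bsub>Fp_bar critical_prime\<^esub> x"
  by (rule ring_simprules)

lift_definition inverse_critical_field :: "critical_field \<Rightarrow> critical_field"
  is "\<lambda>x. if x = \<zero>\<^bsub>Fp_bar critical_prime\<^esub> then \<zero>\<^bsub>Fp_bar critical_prime\<^esub>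
    else inv\<^bsub>Fp_bar critical_prime\<^esub> x"
  by (auto simp: field_Units)

lift_definition divide_critical_field :: "critical_field \<Rightarrow> critical_field \<Rightarrow> critical_field"
  is "\<lambda>x y. if y = \<zero>\<^bsub>Fp_bar critical_prime\<^esub> then \<zero>\<^bsub>Fp_bar critical_prime\<^esub>
    else x \<otimes>\<^bsub>Fp_bar critical_prime\<^esub> inv\<^bsub>Fp_bar critical_prime\<^esub> y"
  by (auto simp: field_Units)

end

lemmas critical_field_rep_eqs =
  zero_critical_field.rep_eq one_critical_field.rep_eq plus_critical_field.rep_eq
  minus_critical_field.rep_eq times_critical_field.rep_eq uminus_critical_field.rep_eq
  inverse_critical_field.rep_eq divide_critical_field.rep_eq

instance
proof -
  interpret field "Fp_bar critical_prime" by (rule field_Fp_bar[OF prime_critical_prime])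
  note eqs = Rep_critical_field_inject[symmetric] critical_field_rep_eqs Rep_critical_field
  show "OFCLASS(critical_field, field_class)"
    by standard (simp_all add: eqs m_ac a_ac r_neg a_minus_def r_distr field_Units)
qed

end

instantiation critical_field ::
  "{unique_euclidean_ring, normalization_euclidean_semiring, normalization_semidom_multiplicative}"
begin

definition [simp]: "normalize_critical_field = (normalize_field :: critical_field \<Rightarrow> _)"
definition [simp]: "unit_factor_critical_field = (unit_factor_field :: critical_field \<Rightarrow> _)"
definition [simp]: "modulo_critical_field = (mod_field :: critical_field \<Rightarrow> _)"
definition [simp]: "euclidean_size_critical_field = (euclidean_size_field :: critical_field \<Rightarrow> _)"
definition [simp]: "division_segment (x :: critical_field) = 1"

instance
  by standard (simp_all add: dvd_field_iff field_split_simps split: if_splits)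

end

instantiation critical_field :: euclidean_ring_gcd
begin

definition gcd_critical_field :: "critical_field \<Rightarrow> critical_field \<Rightarrow> critical_field" where
  "gcd_critical_field = Euclidean_Algorithm.gcd"
definition lcm_critical_field :: "critical_field \<Rightarrow> critical_field \<Rightarrow> critical_field" where
  "lcm_critical_field = Euclidean_Algorithm.lcm"
definition Gcd_critical_field :: "critical_field set \<Rightarrow> critical_field" where
  "Gcd_critical_field = Euclidean_Algorithm.Gcd"
definition Lcm_critical_field :: "critical_field set \<Rightarrow> critical_field" where
  "Lcm_critical_field = Euclidean_Algorithm.Lcm"

instance
  by standard (simp_all add: gcd_critical_field_def lcm_critical_field_def
      Gcd_critical_field_def Lcm_critical_field_def)

end

instance critical_field :: field_gcd ..

lemma critical_field_model: "field_model (Fp_bar critical_prime) Rep_critical_field"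
proof -
  interpret field "Fp_bar critical_prime" by (rule field_Fp_bar[OF prime_critical_prime])
  show ?thesis
  proof (unfold field_model_def cring_model_def cring_model_axioms_def, intro conjI allI)
    show "cring (Fp_bar critical_prime)" by (rule is_cring)
    show "bij_betw Rep_critical_field UNIV (carrier (Fp_bar critical_prime))"
      by (simp add: bij_betw_def inj_on_def Rep_critical_field_inject
          type_definition.Rep_range[OF type_definition_critical_field])
  qed (simp_all add: plus_critical_field.rep_eq times_critical_field.rep_eq one_critical_field.rep_eq)
qed

text \<open>The embedding of the prime field is injective, because it sends a residue to the function
  with that value at the empty multiset.\<close>

lemma critical_field_of_nat_nonzero:
  assumes "0 < k" "k < critical_prime"
  shows "(of_nat k :: critical_field) \<noteq> 0"
proof -
  interpret R: residues_prime critical_prime "residue_ring (int critical_prime)"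
    using prime_critical_prime by (simp add: residues_prime_def)
  interpret F: field_model "Fp_bar critical_prime" Rep_critical_field
    by (rule critical_field_model)
  define c where
    "c = (R.indexed_const :: int \<Rightarrow> (int list \<times> nat) multiset \<Rightarrow> int)"
  have hom: "c \<in> ring_hom (residue_ring (int critical_prime)) (Fp_bar critical_prime)"
    unfolding c_def by (rule Fp_bar_prime_field_hom[OF prime_critical_prime])
  have c0: "c 0 = \<zero>\<^bsub>Fp_bar critical_prime\<^esub>"
    using ring_hom_zero[OF hom R.ring_axioms F.R.ring_axioms] by (simp add: R.res_zero_eq)
  have "Rep_critical_field (of_nat j) = c (int j)" if "j < critical_prime" for j
    using that
  proof (induction j)
    case 0
    then show ?case by (simp add: c0 F.rep_0)
  next
    case (Suc j)
    have "1 + int j = 1 \<oplus>\<^bsub>residue_ring (int critical_prime)\<^esub> int j"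
      using Suc.prems by (simp add: residue_ring_def)
    moreover have "1 \<in> carrier (residue_ring (int critical_prime))"
      "int j \<in> carrier (residue_ring (int critical_prime))"
      using Suc.prems by (auto simp: residue_ring_def)
    ultimately have "c (1 + int j) = c 1 \<oplus>\<^bsub>Fp_bar critical_prime\<^esub> c (int j)"
      using ring_hom_add[OF hom] by simp
    moreover have "c 1 = \<one>\<^bsub>Fp_bar critical_prime\<^esub>"
      using ring_hom_one[OF hom] by (simp add: R.res_one_eq)
    ultimately show ?case using Suc by (simp add: F.rep_add F.rep_1)
  qed
  then have rep_k: "Rep_critical_field (of_nat k) = c (int k)" using assms by simp
  show ?thesis
  proof
    assume "(of_nat k :: critical_field) = 0"
    then have "c (int k) = c 0" using rep_k c0 by (simp add: F.rep_0)
    then have "c (int k) {#} = c 0 {#}" by simp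
    then show False using assms by (simp add: c_def R.indexed_const_def)
  qed
qed

lemma point_bound_Fp_bar:
  assumes "Factorial_Ring.prime p"
  shows "point_bound_holds (Fp_bar p) p"
  by (rule point_bound_from_critical_prime[OF _ assms],
      rule point_bound_of_model[OF critical_field_model critical_field_of_nat_nonzero])

theorem theorem1p2:
  shows "\<exists>c0 :: nat \<Rightarrow> nat \<Rightarrow> real.
    \<forall>(p::nat) (m::nat) (n::nat) (P :: nat \<Rightarrow> nat \<Rightarrow> (int list \<times> nat) multiset \<Rightarrow> int).
      Factorial_Ring.prime p \<and>
      P \<in> carrier (biv (Fp_bar p)) \<and>
      ring_irreducible\<^bsub>biv (Fp_bar p)\<^esub> P \<and>
      deg_X (Fp_bar p) P = m \<and>
      deg_Y (Fp_bar p) P = n \<and>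
      card (bsupp (Fp_bar p) (sharp (Fp_bar p) P)) \<ge> 2 \<and>
      exp_gcd (Fp_bar p) P \<noteq> 0
    \<longrightarrow>
      (\<forall>(G :: ((int list \<times> nat) multiset \<Rightarrow> int) set) (t::nat) (h::nat)
         (l :: nat \<Rightarrow> (int list \<times> nat) multiset \<Rightarrow> int)
         (\<mu> :: nat \<Rightarrow> (int list \<times> nat) multiset \<Rightarrow> int).
        subgroup G (units_of (Fp_bar p)) \<and> finite G \<and> card G = t \<and>
        h \<ge> 1 \<and>
        1 / 2 * real p powr (3 / 4) * real h powr (- 1 / 4) \<ge> real t \<and>
        real t \<ge> max (real h ^ 2) (c0 m n) \<and>
        (\<forall>k\<in>{1..h}. l k \<in> carrier (Fp_bar p) - {\<zero>\<^bsub>Fp_bar p\<^esub>} \<and>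
                     \<mu> k \<in> carrier (Fp_bar p) - {\<zero>\<^bsub>Fp_bar p\<^esub>}) \<and>
        (\<forall>i\<in>{1..h}. \<forall>j\<in>{1..h}. i \<noteq> j \<longrightarrow>
           G_independent (Fp_bar p) G (bscale (Fp_bar p) (l i) (\<mu> i) P)
                                      (bscale (Fp_bar p) (l j) (\<mu> j) P))
      \<longrightarrow>
        real (\<Sum>i=1..h. card {(u, v) \<in> G \<times> G.
            beval (Fp_bar p) (bscale (Fp_bar p) (l i) (\<mu> i) P) u v = \<zero>\<^bsub>Fp_bar p\<^esub>})
          < 12 * real m * real n * (real m + real n) * real_of_int (exp_gcd (Fp_bar p) P)
              * real h powr (2 / 3) * real t powr (2 / 3))"
  by (rule exI[of _ threshold], (rule allI)+, rule impI, erule conjE, drule point_bound_Fp_bar,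
      unfold point_bound_holds_def, (erule allE)+, erule (1) mp)

end
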